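(* Let $G$ be a locally compact Hausdorff group, let $H$ be a closed subgroup of $G$, and let $N$ be a closed normal subgroup of $G$ with $N \subset H \subset G$. Put $\overline{G} := G/N$ and $\overline{H} := H/N$, let $p^{G \to \overline{G}} \colon G \to \overline{G}$ be the canonical map, and write $\overline{h} := p^{G \to \overline{G}}(h)$. Then for every $h \in H$, $$\frac{\Delta_G(h)}{\Delta_{\overline{G}}(\overline{h})} = \frac{\Delta_H(h)}{\Delta_{\overline{H}}(\overline{h})}.$$
   Context: For a locally compact group $L$ with left Haar measure $dl$, the modular function $\Delta_L \colon L \to \mathbb{R}_{>0}$ is the continuous homomorphism with $\int_L f(l x)\, dl = \Delta_L(x)^{-1} \int_L f(l)\, dl$ for all $f \in C_c(L)$ and $x \in L$. *)

theory Defs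
  imports "HOL-Analysis.Analysis" "HOL-Algebra.Coset"
begin

locale topological_group = group G for G :: "('a, 'b) monoid_scheme" (structure) +
  fixes T :: "'a topology"
  assumes topspace_eq: "topspace T = carrier G"
    and continuous_mult: "continuous_map (prod_topology T T) T (\<lambda>(x, y). x \<otimes> y)"
    and continuous_inv: "continuous_map T T (\<lambda>x. inv x)"

locale locally_compact_group = topological_group +
  assumes locally_compact: "locally_compact_space T"
    and Hausdorff: "Hausdorff_space T"

text \<open>The finest topology on the image of \<open>p\<close> making \<open>p\<close> continuous.\<close>

definition quotient_topology :: "'a topology \<Rightarrow> ('a \<Rightarrow> 'b) \<Rightarrow> 'b topology" where
  "quotient_topology T p =
     topology (\<lambda>V. V \<subseteq> p ` topspace T \<and> openin T {x \<in> topspace T. p x \<in> V})"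

lemma openin_quotient_topology:
  "openin (quotient_topology T p) V \<longleftrightarrow>
     V \<subseteq> p ` topspace T \<and> openin T {x \<in> topspace T. p x \<in> V}"
proof -
  let ?P = "\<lambda>V. V \<subseteq> p ` topspace T \<and> openin T {x \<in> topspace T. p x \<in> V}"
  have "istopology ?P"
    unfolding istopology_def
  proof (intro conjI allI impI)
    fix A B assume A: "?P A" and B: "?P B"
    show "A \<inter> B \<subseteq> p ` topspace T" using A by blast
    have "{x \<in> topspace T. p x \<in> A \<inter> B}
        = {x \<in> topspace T. p x \<in> A} \<inter> {x \<in> topspace T. p x \<in> B}" by blast
    then show "openin T {x \<in> topspace T. p x \<in> A \<inter> B}" using A B by auto
  next
    fix \<K> assume K: "\<forall>A\<in>\<K>. ?P A"
    then show "\<Union>\<K> \<subseteq> p ` topspace T" by blast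
    have "{x \<in> topspace T. p x \<in> \<Union>\<K>} = (\<Union>A\<in>\<K>. {x \<in> topspace T. p x \<in> A})" by blast
    then show "openin T {x \<in> topspace T. p x \<in> \<Union>\<K>}" using K by auto
  qed
  then show ?thesis by (simp add: quotient_topology_def topology_inverse')
qed

lemma topspace_quotient_topology [simp]: "topspace (quotient_topology T p) = p ` topspace T"
proof (rule antisym)
  show "topspace (quotient_topology T p) \<subseteq> p ` topspace T"
    using openin_topspace openin_quotient_topology by metis
  have "{x \<in> topspace T. p x \<in> p ` topspace T} = topspace T" by blast
  then have "openin (quotient_topology T p) (p ` topspace T)"
    by (simp add: openin_quotient_topology)
  then show "p ` topspace T \<subseteq> topspace (quotient_topology T p)" by (rule openin_subset)
qed

lemma quotient_map_quotient_topology: "quotient_map T (quotient_topology T p) p"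
  by (auto simp: quotient_map_def openin_quotient_topology)

definition coset_map :: "('a, 'b) monoid_scheme \<Rightarrow> 'a set \<Rightarrow> 'a \<Rightarrow> 'a set" where
  "coset_map G N x = N #>\<^bsub>G\<^esub> x"

definition borel_sets_of :: "'a topology \<Rightarrow> 'a set set" where
  "borel_sets_of T = sigma_sets (topspace T) {U. openin T U}"

definition radon_measure :: "'a topology \<Rightarrow> 'a measure \<Rightarrow> bool" where
  "radon_measure T \<mu> \<longleftrightarrow>
     space \<mu> = topspace T \<and> sets \<mu> = borel_sets_of T \<and>
     (\<forall>K. compactin T K \<longrightarrow> emeasure \<mu> K < \<infinity>) \<and>
     (\<forall>A\<in>sets \<mu>. emeasure \<mu> A = (INF U\<in>{U. openin T U \<and> A \<subseteq> U}. emeasure \<mu> U)) \<and>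
     (\<forall>U. openin T U \<longrightarrow> emeasure \<mu> U = (SUP K\<in>{K. compactin T K \<and> K \<subseteq> U}. emeasure \<mu> K))"

definition left_haar_measure ::
    "('a, 'b) monoid_scheme \<Rightarrow> 'a topology \<Rightarrow> 'a measure \<Rightarrow> bool" where
  "left_haar_measure L T \<mu> \<longleftrightarrow>
     radon_measure T \<mu> \<and> emeasure \<mu> (space \<mu>) \<noteq> 0 \<and>
     (\<forall>x\<in>carrier L. \<forall>A\<in>sets \<mu>. emeasure \<mu> (x <#\<^bsub>L\<^esub> A) = emeasure \<mu> A)"

definition compactly_supported :: "'a topology \<Rightarrow> ('a \<Rightarrow> real) set" where
  "compactly_supported T =
     {f. continuous_map T euclideanreal f \<and>
         compactin T (T closure_of {x \<in> topspace T. f x \<noteq> 0})}"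

text \<open>The modular function is normalised by translating the argument \<open>l\<close> of the
  integrand to \<open>l \<otimes> x\<close>, which gives the factor \<open>inverse (\<Delta> x)\<close>. Left Haar measures are unique
  up to a positive factor, so the identity holds for one of them iff it holds for all.
  The function is fixed to be \<open>undefined\<close> off the carrier so that it is unique as
  a function on the whole type.\<close>

definition is_modular_function ::
    "('a, 'b) monoid_scheme \<Rightarrow> 'a topology \<Rightarrow> ('a \<Rightarrow> real) \<Rightarrow> bool" where
  "is_modular_function L T \<Delta> \<longleftrightarrow>
     \<Delta> \<in> extensional (carrier L) \<and>
     continuous_map T (top_of_set {0<..}) \<Delta> \<and>
     (\<forall>x\<in>carrier L. \<forall>y\<in>carrier L. \<Delta> (x \<otimes>\<^bsub>L\<^esub> y) = \<Delta> x * \<Delta> y) \<and>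
     (\<forall>\<mu>. left_haar_measure L T \<mu> \<longrightarrow>
        (\<forall>f\<in>compactly_supported T. \<forall>x\<in>carrier L.
           (LINT l|\<mu>. f (l \<otimes>\<^bsub>L\<^esub> x)) = inverse (\<Delta> x) * (LINT l|\<mu>. f l)))"

definition modular_function ::
    "('a, 'b) monoid_scheme \<Rightarrow> 'a topology \<Rightarrow> 'a \<Rightarrow> real" where
  "modular_function L T = (THE \<Delta>. is_modular_function L T \<Delta>)"

end

theory Submission
  imports Defs
begin

text \<open>Fix a left Haar measure on \<open>N\<close>. Conjugation by \<open>h\<close> scales it by a factor \<open>\<delta>\<close>. By uniqueness of Haar
  measure, Haar integration on \<open>G\<close> is integration over the cosets of \<open>N\<close> followed by Haar integration
  on \<open>G/N\<close>, and translating by \<open>h\<close> from the right shows that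
  \<open>\<Delta>\<^sub>G(h) / \<Delta>\<^bsub>G/N\<^esub>(hN) = 1 / \<delta>\<close>. The factor \<open>\<delta>\<close> depends only on \<open>N\<close> and \<open>h\<close>, so
  \<open>H\<close> in place of \<open>G\<close> gives the same value.

  Since \<open>modular_function\<close> is a definite description, it is meaningful only once a Haar measure is known
  to exist and to be unique. Existence comes from covering numbers, uniqueness from Weil's
  argument with a Fubini theorem for a Radon measure and a positive functional, which avoids product
  measures and any countability assumption.\<close>

text \<open>Uniqueness is stated for positive left-invariant functionals on
  \<open>compactly_supported\<close>, not for measures: the functional it is finally applied to,
  integration over cosets followed by integration over \<open>G Mod N\<close>, is not given as an
  integral against a measure, and a representation theorem would have to produce one. Stated this
  way it covers right translation and conjugation as well, since each of these turns a
  left-invariant functional into another one. The obstacle to the usual Fubini theorem is that Haar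
  measure on a general locally compact group need not be sigma-finite and that the Borel sets of a
  product can exceed the product sigma-algebra. The integrands that occur are continuous and vanish
  off a compact rectangle, so a finite partition into pieces of small oscillation replaces product
  measures.\<close>

section \<open>Radon measures from contents\<close>

text \<open>\<open>K - U\<close> and \<open>K - V\<close> are disjoint compact sets. Cutting
  disjoint open neighbourhoods of them out of \<open>K\<close> leaves the two parts. This is what
  makes a content finitely subadditive on open sets.\<close>

lemma Hausdorff_compactin_split:
  assumes T: "Hausdorff_space T" and K: "compactin T K"
    and U: "openin T U" and V: "openin T V" and sub: "K \<subseteq> U \<union> V"
  obtains K1 K2 where "compactin T K1" "compactin T K2" "K1 \<subseteq> U" "K2 \<subseteq> V" "K = K1 \<union> K2"
proof -
  have diff: "compactin T (K - W)" if "openin T W" for W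
  proof -
    have "K - W = (topspace T - W) \<inter> K" using compactin_subset_topspace[OF K] by blast
    then show ?thesis
      using closed_Int_compactin[OF closedin_diff[OF closedin_topspace that] K] by simp
  qed
  have "disjnt (K - U) (K - V)" using sub by (auto simp: disjnt_def)
  then obtain U' V' where UV: "openin T U'" "openin T V'" "K - U \<subseteq> U'" "K - V \<subseteq> V'" "disjnt U' V'"
    using Hausdorff_space_compact_separation[OF T diff[OF U] diff[OF V]] by metis
  show thesis
  proof (rule that[of "K - U'" "K - V'"])
    show "K = (K - U') \<union> (K - V')" using UV(5) by (auto simp: disjnt_def)
  qed (use diff UV in auto)
qed

text \<open>Approximating open sets from inside by compact sets, and then arbitrary sets from
  outside by open sets, gives an outer measure to which Caratheodory's construction applies. The
  conclusion speaks of open sets only: the measure of a compact \<open>K\<close> can exceed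
  \<open>c K\<close>, because a content need not be regular.\<close>

lemma content_imp_radon_measure:
  fixes T :: "'a topology" and c :: "'a set \<Rightarrow> real"
  assumes T: "Hausdorff_space T" "locally_compact_space T"
    and nonneg: "\<And>K. compactin T K \<Longrightarrow> 0 \<le> c K"
    and mono: "\<And>K L. compactin T K \<Longrightarrow> compactin T L \<Longrightarrow> K \<subseteq> L \<Longrightarrow> c K \<le> c L"
    and subadd: "\<And>K L. compactin T K \<Longrightarrow> compactin T L \<Longrightarrow> c (K \<union> L) \<le> c K + c L"
    and add: "\<And>K L. compactin T K \<Longrightarrow> compactin T L \<Longrightarrow> K \<inter> L = {} \<Longrightarrow> c (K \<union> L) = c K + c L"
  obtains \<mu> where "radon_measure T \<mu>"
    "\<And>U. openin T U \<Longrightarrow> emeasure \<mu> U = (SUP K\<in>{K. compactin T K \<and> K \<subseteq> U}. ennreal (c K))"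
proof -
  define lo where "lo U = (SUP K\<in>{K. compactin T K \<and> K \<subseteq> U}. ennreal (c K))" for U
  define mu where "mu A = (INF U\<in>{U. openin T U \<and> A \<subseteq> U}. lo U)" for A
  define \<Omega> where "\<Omega> = topspace T"
  have c_empty: "c {} = 0"
    using add[of "{}" "{}"] by simp
  have lo_upper: "ennreal (c K) \<le> lo U" if "compactin T K" "K \<subseteq> U" for K U
    unfolding lo_def by (rule SUP_upper) (use that in auto)
  have lo_least: "lo U \<le> b" if "\<And>K. compactin T K \<Longrightarrow> K \<subseteq> U \<Longrightarrow> ennreal (c K) \<le> b" for U b
    unfolding lo_def by (rule SUP_least) (use that in auto)
  have lo_mono: "lo U \<le> lo V" if "U \<subseteq> V" for U V
    by (rule lo_least, rule lo_upper) (use that in auto)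
  have mu_le: "mu A \<le> lo U" if "openin T U" "A \<subseteq> U" for A U
    unfolding mu_def by (rule INF_lower) (use that in auto)
  have mu_greatest: "b \<le> mu A" if "\<And>U. openin T U \<Longrightarrow> A \<subseteq> U \<Longrightarrow> b \<le> lo U" for A b
    unfolding mu_def by (rule INF_greatest) (use that in auto)
  have mu_open: "mu U = lo U" if "openin T U" for U
    by (rule antisym) (auto intro!: mu_le mu_greatest lo_mono that)
  have mu_mono: "mu A \<le> mu B" if "A \<subseteq> B" for A B
    by (rule mu_greatest, rule mu_le) (use that in auto)
  have mu_empty: "mu {} = 0"
  proof -
    have "lo {} \<le> 0" by (rule lo_least) (simp add: c_empty)
    then show ?thesis using mu_le[of "{}" "{}"] by simp
  qed
  have fin_union: "\<forall>K. compactin T K \<and> K \<subseteq> (\<Union>i<n. U i) \<longrightarrow> ennreal (c K) \<le> (\<Sum>i<n. lo (U i))"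
    if U: "\<And>i. openin T (U i)" for U :: "nat \<Rightarrow> 'a set" and n
  proof (induction n)
    case 0
    show ?case by (auto simp: c_empty)
  next
    case (Suc n)
    show ?case
    proof (intro allI impI, elim conjE)
      fix K assume K: "compactin T K" "K \<subseteq> (\<Union>i<Suc n. U i)"
      have "K \<subseteq> (\<Union>i<n. U i) \<union> U n" using K by (auto simp: lessThan_Suc)
      moreover have "openin T (\<Union>i<n. U i)" using U by auto
      ultimately obtain K1 K2 where K12: "compactin T K1" "compactin T K2" "K1 \<subseteq> (\<Union>i<n. U i)"
          "K2 \<subseteq> U n" "K = K1 \<union> K2"
        using Hausdorff_compactin_split[OF T(1) K(1) _ U] by metis
      have "ennreal (c K) \<le> ennreal (c K1 + c K2)"
        using K12 subadd by (auto intro!: ennreal_leI)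
      also have "\<dots> = ennreal (c K1) + ennreal (c K2)" using nonneg K12 by simp
      also have "\<dots> \<le> (\<Sum>i<n. lo (U i)) + lo (U n)"
        using Suc K12 lo_upper by (intro add_mono) auto
      finally show "ennreal (c K) \<le> (\<Sum>i<Suc n. lo (U i))" by simp
    qed
  qed
  have lo_Union: "lo (\<Union>i. U i) \<le> (\<Sum>i. lo (U i))" if U: "\<And>i. openin T (U i)" for U :: "nat \<Rightarrow> 'a set"
  proof (rule lo_least)
    fix K assume K: "compactin T K" "K \<subseteq> (\<Union>i. U i)"
    obtain \<F> where \<F>: "finite \<F>" "\<F> \<subseteq> range U" "K \<subseteq> \<Union>\<F>"
      using compactinD[OF K(1), of "range U"] K(2) U by blast
    obtain I where I: "finite I" "\<F> = U ` I" using finite_subset_image[OF \<F>(1,2)] by blast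
    obtain n where "I \<subseteq> {..<n}" using I(1) finite_nat_iff_bounded by blast
    then have "(\<Union>i\<in>I. U i) \<subseteq> (\<Union>i<n. U i)" by (intro UN_mono) auto
    then have "K \<subseteq> (\<Union>i<n. U i)" using \<F>(3) unfolding I(2) by (rule subset_trans[rotated])
    then have "ennreal (c K) \<le> (\<Sum>i<n. lo (U i))" using fin_union[of U n, OF U] K(1) by simp
    also have "\<dots> \<le> (\<Sum>i. lo (U i))" by (rule sum_le_suminf) auto
    finally show "ennreal (c K) \<le> (\<Sum>i. lo (U i))" .
  qed
  have csub: "countably_subadditive (Pow \<Omega>) mu"
    unfolding countably_subadditive_def
  proof (intro allI impI)
    fix A :: "nat \<Rightarrow> 'a set" assume A: "range A \<subseteq> Pow \<Omega>" "(\<Union>i. A i) \<in> Pow \<Omega>"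
    show "mu (\<Union>i. A i) \<le> (\<Sum>n. mu (A n))"
    proof (rule ennreal_le_epsilon)
      fix e :: real assume e: "0 < e" and fin: "(\<Sum>n. mu (A n)) < top_class.top"
      have *: "\<And>n. mu (A n) < mu (A n) + e * (1/2)^Suc n"
        using fin e by (auto simp add: less_top dest!: ennreal_suminf_lessD)
      have "\<exists>U. openin T U \<and> A n \<subseteq> U \<and> lo U < mu (A n) + e * (1/2)^Suc n" for n
        using *[of n] unfolding mu_def[of "A n"] INF_less_iff by auto
      then obtain U where U: "\<And>n. openin T (U n)" "\<And>n. A n \<subseteq> U n"
          "\<And>n. lo (U n) < mu (A n) + e * (1/2)^Suc n"
        by metis
      have "mu (\<Union>i. A i) \<le> lo (\<Union>i. U i)" by (rule mu_le) (use U in auto)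
      also have "\<dots> \<le> (\<Sum>i. lo (U i))" by (rule lo_Union) (rule U)
      also have "\<dots> \<le> (\<Sum>n. mu (A n) + ennreal (e * (1/2)^Suc n))"
        by (intro suminf_le less_imp_le U) auto
      also have "\<dots> = (\<Sum>n. mu (A n)) + (\<Sum>n. ennreal e * ennreal ((1/2) ^ Suc n))"
        using e by (subst suminf_add[symmetric])
          (auto simp del: ennreal_suminf_cmult simp add: ennreal_mult[symmetric])
      also have "\<dots> = (\<Sum>n. mu (A n)) + e"
        unfolding ennreal_suminf_cmult
        by (subst suminf_ennreal_eq[OF zero_le_power power_half_series]) auto
      finally show "mu (\<Union>i. A i) \<le> (\<Sum>n. mu (A n)) + ennreal e" .
    qed
  qed
  have oms: "outer_measure_space (Pow \<Omega>) mu"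
    unfolding outer_measure_space_def positive_def increasing_def
    using mu_empty mu_mono csub by blast
  interpret P: sigma_algebra \<Omega> "Pow \<Omega>" by (rule sigma_algebra_Pow)
  have ms: "measure_space \<Omega> (lambda_system \<Omega> (Pow \<Omega>) mu) mu"
    by (rule P.caratheodory_lemma[OF oms])
  have open_lambda: "U \<in> lambda_system \<Omega> (Pow \<Omega>) mu" if U: "openin T U" for U
  proof -
    have "mu (U \<inter> A) + mu ((\<Omega> - U) \<inter> A) = mu A" if A: "A \<subseteq> \<Omega>" for A
    proof (rule antisym)
      show "mu (U \<inter> A) + mu ((\<Omega> - U) \<inter> A) \<le> mu A"
      proof (rule mu_greatest)
        fix W assume W: "openin T W" "A \<subseteq> W"
        \<comment> \<open>As \<open>K\<close> lies in \<open>U\<close>, the open set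
          \<open>W - K\<close> contains what \<open>A\<close> has outside \<open>U\<close>. Any
          compact \<open>L\<close> inside \<open>W - K\<close> is disjoint from \<open>K\<close>, so
          additivity of \<open>c\<close> on disjoint compact sets gives the Caratheodory
          inequality.\<close>
        have step: "ennreal (c K) + mu ((\<Omega> - U) \<inter> A) \<le> lo W"
          if K: "compactin T K" "K \<subseteq> U \<inter> W" for K
        proof -
          have cl: "closedin T K" by (rule compactin_imp_closedin[OF T(1) K(1)])
          have WK: "openin T (W - K)" using W(1) cl by (rule openin_diff)
          have "mu ((\<Omega> - U) \<inter> A) \<le> lo (W - K)"
            by (rule mu_le[OF WK]) (use W K in auto)
          then have "ennreal (c K) + mu ((\<Omega> - U) \<inter> A) \<le> ennreal (c K) + lo (W - K)"
            by (rule add_left_mono)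
          also have "\<dots> = (SUP L\<in>{L. compactin T L \<and> L \<subseteq> W - K}. ennreal (c K) + ennreal (c L))"
            unfolding lo_def by (subst ennreal_SUP_add_right) auto
          also have "\<dots> \<le> lo W"
          proof (rule SUP_least)
            fix L assume "L \<in> {L. compactin T L \<and> L \<subseteq> W - K}"
            then have L: "compactin T L" "L \<subseteq> W - K" by auto
            have "ennreal (c K) + ennreal (c L) = ennreal (c (K \<union> L))"
              using L K nonneg by (subst add) auto
            also have "\<dots> \<le> lo W"
              by (rule lo_upper) (use L K in \<open>auto intro: compactin_Un\<close>)
            finally show "ennreal (c K) + ennreal (c L) \<le> lo W" .
          qed
          finally show ?thesis .
        qed
        have "mu (U \<inter> A) + mu ((\<Omega> - U) \<inter> A) \<le> lo (U \<inter> W) + mu ((\<Omega> - U) \<inter> A)"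
          by (rule add_right_mono, rule mu_le) (use U W in auto)
        also have "\<dots> = (SUP K\<in>{K. compactin T K \<and> K \<subseteq> U \<inter> W}. ennreal (c K) + mu ((\<Omega> - U) \<inter> A))"
          unfolding lo_def by (subst ennreal_SUP_add_left) auto
        also have "\<dots> \<le> lo W" by (rule SUP_least) (use step in auto)
        finally show "mu (U \<inter> A) + mu ((\<Omega> - U) \<inter> A) \<le> lo W" .
      qed
      have "subadditive (Pow \<Omega>) mu"
        using P.countably_subadditive_subadditive[OF _ csub] mu_empty by (simp add: positive_def)
      then have "mu ((U \<inter> A) \<union> ((\<Omega> - U) \<inter> A)) \<le> mu (U \<inter> A) + mu ((\<Omega> - U) \<inter> A)"
        by (rule subadditiveD) (use A in auto)
      moreover have "(U \<inter> A) \<union> ((\<Omega> - U) \<inter> A) = A" using A by blast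
      ultimately show "mu A \<le> mu (U \<inter> A) + mu ((\<Omega> - U) \<inter> A)" by simp
    qed
    then show ?thesis
      using openin_subset[OF U] by (auto simp: lambda_system_def \<Omega>_def)
  qed
  have sa: "sigma_algebra \<Omega> (lambda_system \<Omega> (Pow \<Omega>) mu)"
    using ms by (simp add: measure_space_def)
  have borel_sub: "borel_sets_of T \<subseteq> lambda_system \<Omega> (Pow \<Omega>) mu"
    unfolding borel_sets_of_def \<Omega>_def[symmetric]
    by (rule sigma_algebra.sigma_sets_subset[OF sa]) (use open_lambda in auto)
  have opens: "{U. openin T U} \<subseteq> Pow \<Omega>" using openin_subset by (auto simp: \<Omega>_def)
  have sb: "sigma_algebra \<Omega> (borel_sets_of T)"
    unfolding borel_sets_of_def \<Omega>_def[symmetric] by (rule sigma_algebra_sigma_sets[OF opens])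
  have ms': "measure_space \<Omega> (borel_sets_of T) mu"
    using ms borel_sub sb
    by (auto simp: measure_space_def positive_def countably_additive_def)
  define \<mu> where "\<mu> = measure_of \<Omega> (borel_sets_of T) mu"
  have sp: "space \<mu> = \<Omega>" by (simp add: \<mu>_def sb sigma_algebra.space_measure_of_eq)
  have se: "sets \<mu> = borel_sets_of T"
    by (simp add: \<mu>_def sb sigma_algebra.sets_measure_of_eq)
  have em: "emeasure \<mu> A = mu A" if "A \<in> borel_sets_of T" for A
    unfolding \<mu>_def
    using ms' that sb by (intro emeasure_measure_of_sigma) (auto simp: measure_space_def)
  have open_b: "U \<in> borel_sets_of T" if "openin T U" for U
    using that by (auto simp: borel_sets_of_def)
  have comp_b: "K \<in> borel_sets_of T" if "compactin T K" for K
  proof -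
    have "closedin T K" by (rule compactin_imp_closedin[OF T(1) that])
    then have "openin T (\<Omega> - K)" "K = \<Omega> - (\<Omega> - K)"
      using closedin_subset by (auto simp: \<Omega>_def)
    then show ?thesis
      unfolding borel_sets_of_def \<Omega>_def by (metis mem_Collect_eq sigma_sets.Basic sigma_sets.Compl)
  qed
  have em_open: "emeasure \<mu> U = lo U" if "openin T U" for U
    using em[OF open_b[OF that]] mu_open[OF that] by simp
  have c_le: "ennreal (c K) \<le> emeasure \<mu> K" if "compactin T K" for K
    using em[OF comp_b[OF that]] mu_greatest[of K "ennreal (c K)"] lo_upper[OF that] by simp
  have "radon_measure T \<mu>"
    unfolding radon_measure_def
  proof (intro conjI allI ballI impI)
    show "space \<mu> = topspace T" by (simp add: sp \<Omega>_def)
    show "sets \<mu> = borel_sets_of T" by (rule se)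
  next
    fix K assume K: "compactin T K"
    \<comment> \<open>Local finiteness: a compact neighbourhood \<open>L\<close> of \<open>K\<close>
      bounds \<open>lo\<close> on its open part by the real number \<open>c L\<close>.\<close>
    then obtain U L where UL: "openin T U" "compactin T L" "K \<subseteq> U" "U \<subseteq> L"
      using locally_compact_space_compact_closed_compact[of T] T by metis
    have "emeasure \<mu> K \<le> lo U" using em[OF comp_b[OF K]] mu_le[OF UL(1,3)] by simp
    also have "\<dots> \<le> ennreal (c L)"
      by (rule lo_least, rule ennreal_leI, rule mono) (use UL in auto)
    also have "\<dots> < \<infinity>" by simp
    finally show "emeasure \<mu> K < \<infinity>" .
  next
    fix A assume "A \<in> sets \<mu>"
    then show "emeasure \<mu> A = (INF U\<in>{U. openin T U \<and> A \<subseteq> U}. emeasure \<mu> U)"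
      by (auto simp: se em mu_def em_open intro!: INF_cong)
  next
    fix U assume U: "openin T U"
    show "emeasure \<mu> U = (SUP K\<in>{K. compactin T K \<and> K \<subseteq> U}. emeasure \<mu> K)"
    proof (rule antisym)
      \<comment> \<open>\<open>lo\<close> is a supremum of values of \<open>c\<close>, which are
        only lower bounds for the measure of compact sets; for inner regularity that is
        enough.\<close>
      show "emeasure \<mu> U \<le> (SUP K\<in>{K. compactin T K \<and> K \<subseteq> U}. emeasure \<mu> K)"
        unfolding em_open[OF U] lo_def by (rule SUP_mono) (use c_le in auto)
      show "(SUP K\<in>{K. compactin T K \<and> K \<subseteq> U}. emeasure \<mu> K) \<le> emeasure \<mu> U"
        using U by (auto intro!: SUP_least emeasure_mono simp: se open_b)
    qed
  qed
  then show thesis using that em_open lo_def by simp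
qed

lemma measurable_continuous_map:
  assumes f: "continuous_map T T' f" and "space \<mu> = topspace T" "sets \<mu> = borel_sets_of T"
    and "space \<nu> = topspace T'" "sets \<nu> = borel_sets_of T'"
  shows "f \<in> measurable \<mu> \<nu>"
proof (rule measurableI)
  show "f x \<in> space \<nu>" if "x \<in> space \<mu>" for x
    using that f assms continuous_map_image_subset_topspace by fastforce
  fix A assume "A \<in> sets \<nu>"
  then have "A \<in> sigma_sets (topspace T') {U. openin T' U}"
    using assms by (simp add: borel_sets_of_def)
  then show "f -` A \<inter> space \<mu> \<in> sets \<mu>"
  proof (induction)
    case (Basic U)
    then have "openin T {x \<in> topspace T. f x \<in> U}"
      using f openin_continuous_map_preimage by blast
    moreover have "f -` U \<inter> space \<mu> = {x \<in> topspace T. f x \<in> U}" using assms(2) by auto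
    ultimately show ?case by (simp add: assms borel_sets_of_def)
  next
    case (Compl A)
    have "f -` (topspace T' - A) \<inter> space \<mu> = space \<mu> - (f -` A \<inter> space \<mu>)"
      using f assms continuous_map_image_subset_topspace by fastforce
    then show ?case using Compl by auto
  next
    case (Union A)
    have "(\<Union>i. f -` A i \<inter> space \<mu>) \<in> sets \<mu>"
      by (rule sets.countable_UN) (use Union.IH in blast)
    moreover have "f -` (\<Union>i. A i) \<inter> space \<mu> = (\<Union>i. f -` A i \<inter> space \<mu>)" by auto
    ultimately show ?case by simp
  qed simp
qed

section \<open>Existence of Haar measure\<close>

lemma (in group) mult_inv_cancel:
  assumes "x \<in> carrier G" "y \<in> carrier G"
  shows "x \<otimes> (inv x \<otimes> y) = y" "inv x \<otimes> (x \<otimes> y) = y"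
  using assms by (simp_all add: m_assoc[symmetric])

section \<open>Translates of sets in a topological group, and covering numbers\<close>

context topological_group
begin

lemma openin_subset_carrier: "openin T U \<Longrightarrow> U \<subseteq> carrier G"
  using openin_subset topspace_eq by blast

lemma compactin_subset_carrier: "compactin T K \<Longrightarrow> K \<subseteq> carrier G"
  using compactin_subset_topspace topspace_eq by blast

lemma continuous_map_group_mult:
  assumes "continuous_map X T f" and "continuous_map X T g"
  shows "continuous_map X T (\<lambda>x. f x \<otimes> g x)"
  using continuous_map_compose[OF continuous_map_pairedI[OF assms] continuous_mult]
  by (simp add: o_def)

lemma continuous_map_group_inv:
  "continuous_map X T f \<Longrightarrow> continuous_map X T (\<lambda>x. inv (f x))"
  using continuous_map_compose[OF _ continuous_inv] by (simp add: o_def)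

lemma continuous_map_group_const: "a \<in> carrier G \<Longrightarrow> continuous_map X T (\<lambda>x. a)"
  by (simp add: topspace_eq)

lemmas continuous_group_intros =
  continuous_map_group_mult continuous_map_group_inv continuous_map_group_const
  continuous_map_id[unfolded id_def]

lemma l_coset_image: "x <# A = (\<lambda>a. x \<otimes> a) ` A"
  by (auto simp: l_coset_def)

text \<open>A translate written as a preimage inherits openness and measurability from continuity of
  left multiplication.\<close>

lemma l_coset_vimage:
  assumes "x \<in> carrier G" "A \<subseteq> carrier G"
  shows "x <# A = {y \<in> carrier G. inv x \<otimes> y \<in> A}"
proof -
  have "y \<in> x <# A" if "y \<in> carrier G" "inv x \<otimes> y \<in> A" for y
  proof -
    have "x \<otimes> (inv x \<otimes> y) = y" using that assms mult_inv_cancel by simp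
    then show ?thesis unfolding l_coset_image using that by force
  qed
  moreover have "inv x \<otimes> (x \<otimes> a) = a" if "a \<in> A" for a
    using that assms mult_inv_cancel by blast
  ultimately show ?thesis using assms by (auto simp: l_coset_image)
qed

lemma openin_l_coset:
  assumes "x \<in> carrier G" "openin T U"
  shows "openin T (x <# U)"
proof -
  have "continuous_map T T (\<lambda>y. inv x \<otimes> y)"
    using assms by (intro continuous_group_intros) auto
  then have "openin T {y \<in> topspace T. inv x \<otimes> y \<in> U}"
    using assms(2) by (rule openin_continuous_map_preimage)
  then show ?thesis
    using l_coset_vimage[OF assms(1) openin_subset_carrier[OF assms(2)]] by (simp add: topspace_eq)
qed

lemma compactin_l_coset:
  assumes "x \<in> carrier G" "compactin T K"
  shows "compactin T (x <# K)"
  unfolding l_coset_image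
  by (rule image_compactin[OF assms(2)]) (use assms in \<open>auto intro!: continuous_group_intros\<close>)

lemma l_coset_inv_cancel:
  assumes "x \<in> carrier G" "A \<subseteq> carrier G"
  shows "inv x <# (x <# A) = A" "x <# (inv x <# A) = A"
  using assms by (simp_all add: lcos_m_assoc lcos_mult_one)

lemma compactin_set_mult:
  assumes "compactin T K" "compactin T L"
  shows "compactin T (K <#> L)"
proof -
  have "K <#> L = (\<lambda>(x, y). x \<otimes> y) ` (K \<times> L)" by (auto simp: set_mult_def)
  then show ?thesis
    using image_compactin[OF _ continuous_mult, of "K \<times> L"] assms by (simp add: compactin_Times)
qed

lemma compactin_inv_image: "compactin T K \<Longrightarrow> compactin T ((\<lambda>x. inv x) ` K)"
  using image_compactin continuous_inv by blast

text \<open>Haar's index (K : V). The \<open>LEAST\<close> is meaningful when some finite cover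
  exists, as it does for compact \<open>K\<close> and an open neighbourhood \<open>V\<close> of the
  identity.\<close>

definition covering_number :: "'a set \<Rightarrow> 'a set \<Rightarrow> nat" where
  "covering_number K V =
     (LEAST n. \<exists>S. finite S \<and> S \<subseteq> carrier G \<and> card S = n \<and> K \<subseteq> (\<Union>s\<in>S. s <# V))"

lemma covering_number_le:
  "finite S \<Longrightarrow> S \<subseteq> carrier G \<Longrightarrow> K \<subseteq> (\<Union>s\<in>S. s <# V) \<Longrightarrow> covering_number K V \<le> card S"
  unfolding covering_number_def by (rule Least_le) blast

lemma covering_numberE:
  assumes K: "compactin T K" and V: "openin T V" "\<one> \<in> V"
  obtains S where "finite S" "S \<subseteq> carrier G" "card S = covering_number K V"
    "K \<subseteq> (\<Union>s\<in>S. s <# V)"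
proof -
  note Kc = compactin_subset_carrier[OF K]
  have "x \<in> x <# V" if "x \<in> K" for x
    unfolding l_coset_image using V(2) Kc that by force
  then have "K \<subseteq> \<Union>((\<lambda>x. x <# V) ` K)" by blast
  moreover have "\<And>U. U \<in> (\<lambda>x. x <# V) ` K \<Longrightarrow> openin T U" using V Kc openin_l_coset by auto
  ultimately obtain \<F> where "finite \<F>" "\<F> \<subseteq> (\<lambda>x. x <# V) ` K" "K \<subseteq> \<Union>\<F>"
    using compactinD[OF K] by metis
  then obtain S where "S \<subseteq> K" "finite S" "K \<subseteq> (\<Union>s\<in>S. s <# V)"
    by (metis finite_subset_image)
  then have "\<exists>n S. finite S \<and> S \<subseteq> carrier G \<and> card S = n \<and> K \<subseteq> (\<Union>s\<in>S. s <# V)"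
    using Kc by blast
  from LeastI_ex[OF this] show thesis using that unfolding covering_number_def by blast
qed

lemma covering_number_mono:
  assumes "compactin T L" "openin T V" "\<one> \<in> V" "K \<subseteq> L"
  shows "covering_number K V \<le> covering_number L V"
proof -
  obtain S where "finite S" "S \<subseteq> carrier G" "card S = covering_number L V" "L \<subseteq> (\<Union>s\<in>S. s <# V)"
    using covering_numberE assms by metis
  then show ?thesis using covering_number_le[of S K V] assms(4) by auto
qed

lemma covering_number_Un:
  assumes "compactin T K" "compactin T L" "openin T V" "\<one> \<in> V"
  shows "covering_number (K \<union> L) V \<le> covering_number K V + covering_number L V"
proof -
  obtain R where R: "finite R" "R \<subseteq> carrier G" "card R = covering_number K V" "K \<subseteq> (\<Union>s\<in>R. s <# V)"
    using covering_numberE assms by metis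
  obtain S where S: "finite S" "S \<subseteq> carrier G" "card S = covering_number L V" "L \<subseteq> (\<Union>s\<in>S. s <# V)"
    using covering_numberE assms by metis
  have "covering_number (K \<union> L) V \<le> card (R \<union> S)"
    using R S by (intro covering_number_le) auto
  also have "\<dots> \<le> card R + card S" by (rule card_Un_le)
  finally show ?thesis using R S by simp
qed

text \<open>In an optimal cover of the union, the translates that meet \<open>K\<close> miss
  \<open>L\<close>, so the cover splits into a cover of \<open>K\<close> and a disjoint cover of
  \<open>L\<close>.\<close>

lemma covering_number_Un_separated:
  assumes "compactin T K" "compactin T L" "openin T V" "\<one> \<in> V"
    and sep: "\<And>s. s \<in> carrier G \<Longrightarrow> (s <# V) \<inter> K = {} \<or> (s <# V) \<inter> L = {}"
  shows "covering_number (K \<union> L) V = covering_number K V + covering_number L V"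
proof (rule antisym[OF covering_number_Un[OF assms(1-4)]])
  obtain S where S: "finite S" "S \<subseteq> carrier G" "card S = covering_number (K \<union> L) V"
      "K \<union> L \<subseteq> (\<Union>s\<in>S. s <# V)"
    using covering_numberE compactin_Un assms by metis
  define A where "A = {s \<in> S. (s <# V) \<inter> K \<noteq> {}}"
  have "covering_number K V \<le> card A"
  proof (rule covering_number_le)
    show "K \<subseteq> (\<Union>s\<in>A. s <# V)" using S(4) by (force simp: A_def)
  qed (use S in \<open>auto simp: A_def\<close>)
  moreover have "covering_number L V \<le> card (S - A)"
  proof (rule covering_number_le)
    show "L \<subseteq> (\<Union>s\<in>S - A. s <# V)"
    proof
      fix y assume y: "y \<in> L"
      then obtain s where s: "s \<in> S" "y \<in> s <# V" using S by blast
      then have "s \<notin> A" using sep[of s] S y by (auto simp: A_def)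
      then show "y \<in> (\<Union>s\<in>S - A. s <# V)" using s by blast
    qed
  qed (use S in auto)
  moreover have "card A + card (S - A) = card S"
    using S by (metis (no_types, lifting) A_def card_Diff_subset card_mono finite_subset le_add_diff_inverse mem_Collect_eq subsetI)
  ultimately show "covering_number K V + covering_number L V \<le> covering_number (K \<union> L) V"
    using S(3) by simp
qed

text \<open>Left translates of \<open>V\<close> are permuted by left translation. One inequality
  suffices, since it can be applied to \<open>inv x\<close> as well.\<close>

lemma covering_number_l_coset:
  assumes x: "x \<in> carrier G" and K: "compactin T K" and V: "openin T V" "\<one> \<in> V"
  shows "covering_number (x <# K) V = covering_number K V"
proof -
  have le: "covering_number (y <# L) V \<le> covering_number L V"
    if y: "y \<in> carrier G" and L: "compactin T L" for y L
  proof -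
    obtain S where S: "finite S" "S \<subseteq> carrier G" "card S = covering_number L V"
        "L \<subseteq> (\<Union>s\<in>S. s <# V)"
      using covering_numberE[OF L V] by metis
    note Vc = openin_subset_carrier[OF V(1)]
    have "y <# L \<subseteq> (\<Union>s\<in>(\<lambda>s. y \<otimes> s) ` S. s <# V)"
    proof
      fix z assume "z \<in> y <# L"
      then obtain l where l: "l \<in> L" "z = y \<otimes> l" by (auto simp: l_coset_image)
      then obtain s v where sv: "s \<in> S" "v \<in> V" "l = s \<otimes> v"
        using S(4) by (force simp: l_coset_image)
      then have "z = (y \<otimes> s) \<otimes> v" using l y S(2) Vc by (auto simp: m_assoc subset_iff)
      then show "z \<in> (\<Union>s\<in>(\<lambda>s. y \<otimes> s) ` S. s <# V)"
        using sv by (auto simp: l_coset_image)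
    qed
    then have "covering_number (y <# L) V \<le> card ((\<lambda>s. y \<otimes> s) ` S)"
      using S y by (intro covering_number_le) auto
    also have "\<dots> \<le> card S" by (rule card_image_le[OF S(1)])
    finally show ?thesis using S(3) by simp
  qed
  show ?thesis
  proof (rule antisym)
    show "covering_number (x <# K) V \<le> covering_number K V" by (rule le[OF x K])
    show "covering_number K V \<le> covering_number (x <# K) V"
      using le[of "inv x" "x <# K"] x compactin_l_coset[OF x K]
        l_coset_inv_cancel[OF x compactin_subset_carrier[OF K]] by simp
  qed
qed

text \<open>Refining a cover by translates of \<open>U\<close> with a cover of \<open>L\<close>
  multiplies the counts. With \<open>L\<close> as the normalising set, this bounds the ratio of the
  indices of \<open>K\<close> and \<open>L\<close> independently of \<open>V\<close>.\<close>

lemma covering_number_trans: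
  assumes K: "compactin T K" and L: "compactin T L" and U: "openin T U" "\<one> \<in> U" "U \<subseteq> L"
    and V: "openin T V" "\<one> \<in> V"
  shows "covering_number K V \<le> covering_number K U * covering_number L V"
proof -
  obtain R where R: "finite R" "R \<subseteq> carrier G" "card R = covering_number K U" "K \<subseteq> (\<Union>s\<in>R. s <# U)"
    using covering_numberE[OF K U(1,2)] by metis
  obtain S where S: "finite S" "S \<subseteq> carrier G" "card S = covering_number L V" "L \<subseteq> (\<Union>s\<in>S. s <# V)"
    using covering_numberE[OF L V] by metis
  let ?Q = "(\<lambda>(r, s). r \<otimes> s) ` (R \<times> S)"
  have "K \<subseteq> (\<Union>s\<in>?Q. s <# V)"
  proof
    fix k assume "k \<in> K"
    then obtain r u where r: "r \<in> R" "u \<in> U" "k = r \<otimes> u" using R(4) by (force simp: l_coset_image)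
    then obtain s v where s: "s \<in> S" "v \<in> V" "u = s \<otimes> v"
      using S(4) U(3) by (force simp: l_coset_image)
    have "k = (r \<otimes> s) \<otimes> v"
      using r s R(2) S(2) openin_subset_carrier[OF V(1)] by (auto simp: m_assoc subset_iff)
    moreover have "r \<otimes> s \<in> ?Q" using r s by force
    ultimately show "k \<in> (\<Union>s\<in>?Q. s <# V)" using s(2) unfolding l_coset_image by blast
  qed
  then have "covering_number K V \<le> card ?Q"
    using R S by (intro covering_number_le) auto
  also have "\<dots> \<le> card (R \<times> S)" using R S by (intro card_image_le) auto
  finally show ?thesis using R S by (simp add: card_cartesian_product)
qed

lemma covering_number_pos:
  assumes "compactin T K" "openin T V" "\<one> \<in> V" "K \<noteq> {}"
  shows "0 < covering_number K V"
proof -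
  obtain S where "finite S" "card S = covering_number K V" "K \<subseteq> (\<Union>s\<in>S. s <# V)"
    using covering_numberE assms by metis
  then show ?thesis using assms(4) by (cases "S = {}") (auto simp: card_gt_0_iff)
qed

text \<open>If \<open>s <# V\<close> met both sets, in sv and sw, then (sv) v^-1 w would lie in
  \<open>L\<close>. The map (k, v, w) to k v^-1 w sends \<open>K\<close> times the identity pair
  outside \<open>L\<close>, and the tube lemma makes this uniform over the compact set
  \<open>K\<close>.\<close>

lemma disjoint_compactin_separated:
  assumes T2: "Hausdorff_space T" and K: "compactin T K" and L: "compactin T L" and dis: "K \<inter> L = {}"
  obtains V where "openin T V" "\<one> \<in> V"
    "\<And>s. s \<in> carrier G \<Longrightarrow> (s <# V) \<inter> K = {} \<or> (s <# V) \<inter> L = {}"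
proof -
  let ?X = "prod_topology T (prod_topology T T)"
  let ?f = "\<lambda>p. fst p \<otimes> inv (fst (snd p)) \<otimes> snd (snd p)"
  let ?W = "{p \<in> topspace ?X. ?f p \<in> topspace T - L}"
  have cont: "continuous_map ?X T ?f"
    by (intro continuous_group_intros continuous_map_fst continuous_map_fst_of continuous_map_snd_of
        continuous_map_compose[OF continuous_map_snd, unfolded o_def])
  have "openin T (topspace T - L)"
    using compactin_imp_closedin[OF T2 L] by blast
  then have W: "openin ?X ?W"
    using openin_continuous_map_preimage[OF cont] by blast
  have "K \<times> {(\<one>, \<one>)} \<subseteq> ?W"
    using compactin_subset_carrier[OF K] dis by (auto simp: topspace_eq subset_iff disjoint_iff)
  then obtain U V' where UV: "openin T U" "openin (prod_topology T T) V'" "K \<subseteq> U" "(\<one>, \<one>) \<in> V'"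
      "U \<times> V' \<subseteq> ?W"
    using tube_lemma_left[OF W K, of "(\<one>, \<one>)"] by (auto simp: topspace_eq)
  obtain V1 V2 where V: "openin T V1" "openin T V2" "\<one> \<in> V1" "\<one> \<in> V2" "V1 \<times> V2 \<subseteq> V'"
    using UV(2,4) unfolding openin_prod_topology_alt by metis
  show thesis
  proof (rule that[of "V1 \<inter> V2"])
    fix s assume s: "s \<in> carrier G"
    show "(s <# (V1 \<inter> V2)) \<inter> K = {} \<or> (s <# (V1 \<inter> V2)) \<inter> L = {}"
    proof (rule ccontr)
      assume "\<not> ?thesis"
      then obtain v w where vw: "v \<in> V1" "w \<in> V2" "s \<otimes> v \<in> K" "s \<otimes> w \<in> L"
        by (auto simp: l_coset_image)
      then have "(s \<otimes> v, (v, w)) \<in> ?W" using UV V by blast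
      moreover have vwc: "v \<in> carrier G" "w \<in> carrier G"
        using vw V openin_subset_carrier by blast+
      moreover have "s \<otimes> v \<otimes> inv v \<otimes> w = s \<otimes> w" using vwc s by (simp add: m_assoc)
      ultimately show False using vw by simp
    qed
  qed (use V in auto)
qed

end

section \<open>From covering numbers to an invariant Radon measure\<close>

context locally_compact_group
begin

text \<open>The covering numbers by translates of \<open>V\<close>, normalised by those of \<open>K0\<close>, lie in a compact product
  of intervals that does not depend on \<open>V\<close>, and are additive on sets that no translate of \<open>V\<close> meets
  simultaneously. As \<open>V\<close> shrinks, compactness yields a set function with all these properties
  at once.\<close>

lemma haar_content_exists:
  obtains c :: "'a set \<Rightarrow> real" and K0 where
    "\<And>K. 0 \<le> c K"
    "\<And>K L. compactin T K \<Longrightarrow> compactin T L \<Longrightarrow> K \<subseteq> L \<Longrightarrow> c K \<le> c L"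
    "\<And>K L. compactin T K \<Longrightarrow> compactin T L \<Longrightarrow> c (K \<union> L) \<le> c K + c L"
    "\<And>K L. compactin T K \<Longrightarrow> compactin T L \<Longrightarrow> K \<inter> L = {} \<Longrightarrow> c (K \<union> L) = c K + c L"
    "\<And>x K. x \<in> carrier G \<Longrightarrow> compactin T K \<Longrightarrow> c (x <# K) = c K"
    "compactin T K0" "c K0 = 1"
proof -
  obtain U0 K0 where U0: "openin T U0" "\<one> \<in> U0" "U0 \<subseteq> K0" and K0: "compactin T K0"
    using locally_compact unfolding locally_compact_space_def topspace_eq by (metis one_closed)
  have K0_ne: "K0 \<noteq> {}" using U0 by blast
  define N where "N = {V. openin T V \<and> \<one> \<in> V}"
  \<comment> \<open>The box \<open>P\<close> has a coordinate for every set, compact or not. The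
    value 0 on non-compact sets collapses those coordinates to a point, so that \<open>q V\<close>
    lies in \<open>P\<close>.\<close>
  define b where "b K = (if compactin T K then real (covering_number K U0) else 0)" for K
  define q where "q V K = (if compactin T K then real (covering_number K V) / real (covering_number K0 V) else 0)"
    for V K
  define sep where "sep V K L \<longleftrightarrow> (\<forall>s\<in>carrier G. (s <# V) \<inter> K = {} \<or> (s <# V) \<inter> L = {})" for V K L
  define P where "P = (PiE UNIV (\<lambda>K. {0..b K}) :: ('a set \<Rightarrow> real) set)"
  define C where "C V = {f :: 'a set \<Rightarrow> real.
      (\<forall>K L. compactin T K \<and> compactin T L \<and> K \<subseteq> L \<longrightarrow> f K \<le> f L) \<and>
      (\<forall>K L. compactin T K \<and> compactin T L \<longrightarrow> f (K \<union> L) \<le> f K + f L) \<and>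
      (\<forall>K L. compactin T K \<and> compactin T L \<and> sep V K L \<longrightarrow> f (K \<union> L) = f K + f L) \<and>
      (\<forall>x K. x \<in> carrier G \<and> compactin T K \<longrightarrow> f (x <# K) = f K) \<and> f K0 = 1}" for V
  have "compactin (product_topology (\<lambda>i. euclidean) UNIV) P"
    unfolding P_def compactin_PiE by simp
  then have P: "compact P"
    by (simp add: euclidean_product_topology)
  \<comment> \<open>Each condition compares finitely many coordinates, which are continuous in the
    product topology.\<close>
  have closed: "closed (C V)" for V
    unfolding C_def
    by (intro closed_Collect_conj closed_Collect_all closed_Collect_imp closed_Collect_le
        closed_Collect_eq open_Collect_const continuous_intros continuous_on_product_coordinates)
  have qP: "q V \<in> P" if V: "V \<in> N" for V
  proof -
    have "real (covering_number K V) / real (covering_number K0 V) \<le> real (covering_number K U0)"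
      if K: "compactin T K" for K
    proof -
      have "covering_number K V \<le> covering_number K U0 * covering_number K0 V"
        using covering_number_trans[OF K K0 U0] V by (simp add: N_def)
      moreover have "0 < covering_number K0 V"
        using covering_number_pos[OF K0 _ _ K0_ne] V by (simp add: N_def)
      ultimately show ?thesis
        by (metis of_nat_0_less_iff of_nat_le_iff of_nat_mult pos_divide_le_eq)
    qed
    then show ?thesis by (auto simp: P_def q_def b_def)
  qed
  have qC: "q W \<in> C V" if W: "W \<in> N" "W \<subseteq> V" for V W
  proof -
    have WN: "openin T W" "\<one> \<in> W" using W by (auto simp: N_def)
    have pos: "0 < covering_number K0 W"
      using covering_number_pos[OF K0 WN K0_ne] .
    \<comment> \<open>A smaller neighbourhood separates more pairs. Hence \<open>q W\<close>
      satisfies the conditions of every larger \<open>V\<close>, which gives the finite intersection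
      property.\<close>
    have sep: "sep W K L" if "sep V K L" for K L
      using that W(2) unfolding sep_def l_coset_def by blast
    have 1: "q W K \<le> q W L" if "compactin T K" "compactin T L" "K \<subseteq> L" for K L
      using that covering_number_mono[OF that(2) WN that(3)]
      by (auto simp: q_def intro!: divide_right_mono)
    have 2: "q W (K \<union> L) \<le> q W K + q W L" if "compactin T K" "compactin T L" for K L
      using that covering_number_Un[OF that WN] compactin_Un[OF that]
      by (auto simp: q_def add_divide_distrib[symmetric] simp del: of_nat_add simp add: of_nat_add[symmetric] intro!: divide_right_mono)
    have 3: "q W (K \<union> L) = q W K + q W L" if "compactin T K" "compactin T L" "sep V K L" for K L
      using that covering_number_Un_separated[OF that(1,2) WN] compactin_Un[OF that(1,2)] sep[OF that(3)]
      by (auto simp: q_def add_divide_distrib[symmetric] sep_def)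
    have 4: "q W (x <# K) = q W K" if "x \<in> carrier G" "compactin T K" for x K
      using covering_number_l_coset[OF that WN] compactin_l_coset[OF that] that by (simp add: q_def)
    have 5: "q W K0 = 1" using pos K0 by (simp add: q_def)
    show ?thesis unfolding C_def using 1 2 3 4 5 by blast
  qed
  have "P \<inter> (\<Inter>V\<in>N. C V) \<noteq> {}"
  proof (rule compact_imp_fip_image[OF P closed])
    fix I assume I: "finite I" "I \<subseteq> N"
    \<comment> \<open>Inserting the carrier covers the case of empty \<open>I\<close>, whose
      intersection would be the whole type.\<close>
    define W where "W = \<Inter>(insert (carrier G) I)"
    have "openin T W"
      unfolding W_def using I openin_topspace[of T] by (intro openin_Inter) (auto simp: N_def topspace_eq)
    then have W: "W \<in> N" using I by (auto simp: N_def W_def)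
    have "q W \<in> C V" if "V \<in> I" for V
      by (rule qC[OF W]) (use that in \<open>auto simp: W_def\<close>)
    then show "P \<inter> (\<Inter>V\<in>I. C V) \<noteq> {}" using qP[OF W] by blast
  qed
  then obtain c where c: "c \<in> P" "\<And>V. V \<in> N \<Longrightarrow> c \<in> C V" by blast
  \<comment> \<open>All conditions except additivity are the same for every \<open>V\<close>, so
    they can be read off at the largest neighbourhood.\<close>
  have cC: "c \<in> C (carrier G)"
    using c(2) openin_topspace[of T] by (simp add: N_def topspace_eq)
  show thesis
  proof (rule that[of c K0])
    show "0 \<le> c K" for K
    proof -
      have "c K \<in> {0..b K}" using c(1) unfolding P_def by (rule PiE_mem) simp
      then show ?thesis by simp
    qed
    show "c (K \<union> L) = c K + c L" if KL: "compactin T K" "compactin T L" "K \<inter> L = {}" for K L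
    proof -
      obtain V where V: "openin T V" "\<one> \<in> V" "sep V K L"
        using disjoint_compactin_separated[OF Hausdorff KL] unfolding sep_def by metis
      then have "c \<in> C V" using c(2) by (simp add: N_def)
      then show ?thesis using V KL by (simp add: C_def)
    qed
  qed (use cC K0 in \<open>simp_all add: C_def\<close>)
qed

text \<open>Invariance passes from the content to open sets through inner approximation, and from
  there to Borel sets through outer regularity. The set \<open>K0\<close> of content 1 keeps the
  measure from being zero.\<close>

lemma left_haar_measure_exists: "\<exists>\<mu>. left_haar_measure G T \<mu>"
proof -
  obtain c K0 where c: "\<And>K. 0 \<le> c K"
    "\<And>K L. compactin T K \<Longrightarrow> compactin T L \<Longrightarrow> K \<subseteq> L \<Longrightarrow> c K \<le> c L"
    "\<And>K L. compactin T K \<Longrightarrow> compactin T L \<Longrightarrow> c (K \<union> L) \<le> c K + c L"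
    "\<And>K L. compactin T K \<Longrightarrow> compactin T L \<Longrightarrow> K \<inter> L = {} \<Longrightarrow> c (K \<union> L) = c K + (c L :: real)"
    and inv: "\<And>x K. x \<in> carrier G \<Longrightarrow> compactin T K \<Longrightarrow> c (x <# K) = c K"
    and K0: "compactin T K0" "c K0 = 1"
    using haar_content_exists by blast
  obtain \<mu> where \<mu>: "radon_measure T \<mu>"
    and open_eq: "\<And>U. openin T U \<Longrightarrow> emeasure \<mu> U = (SUP K\<in>{K. compactin T K \<and> K \<subseteq> U}. ennreal (c K))"
    using content_imp_radon_measure[OF Hausdorff locally_compact c] by blast
  have sp: "space \<mu> = carrier G" and se: "sets \<mu> = borel_sets_of T"
    and outer: "\<And>A. A \<in> sets \<mu> \<Longrightarrow> emeasure \<mu> A = (INF U\<in>{U. openin T U \<and> A \<subseteq> U}. emeasure \<mu> U)"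
    using \<mu> by (auto simp: radon_measure_def topspace_eq)
  have carrier_open: "openin T (carrier G)" using openin_topspace[of T] by (simp add: topspace_eq)
  have "ennreal (c K0) \<le> emeasure \<mu> (space \<mu>)"
    unfolding sp open_eq[OF carrier_open]
    by (rule SUP_upper) (use K0 compactin_subset_carrier in auto)
  then have nz: "emeasure \<mu> (space \<mu>) \<noteq> 0" using K0 by auto
  have open_le: "emeasure \<mu> U \<le> emeasure \<mu> (x <# U)" if x: "x \<in> carrier G" and U: "openin T U" for x U
    unfolding open_eq[OF U] open_eq[OF openin_l_coset[OF x U]]
  proof (rule SUP_least)
    fix K assume "K \<in> {K. compactin T K \<and> K \<subseteq> U}"
    then have K: "compactin T K" "K \<subseteq> U" by auto
    have "x <# K \<subseteq> x <# U" using K by (auto simp: l_coset_image)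
    then show "ennreal (c K) \<le> (SUP K\<in>{K. compactin T K \<and> K \<subseteq> x <# U}. ennreal (c K))"
      using inv[OF x K(1)] compactin_l_coset[OF x K(1)] by (intro SUP_upper2[of "x <# K"]) auto
  qed
  have sets_l_coset: "x <# A \<in> sets \<mu>" if x: "x \<in> carrier G" and A: "A \<in> sets \<mu>" for x A
  proof -
    have "(\<lambda>y. inv x \<otimes> y) \<in> measurable \<mu> \<mu>"
      by (rule measurable_continuous_map[where T = T and T' = T])
        (use x in \<open>auto intro!: continuous_group_intros simp: sp se topspace_eq\<close>)
    then have "(\<lambda>y. inv x \<otimes> y) -` A \<inter> space \<mu> \<in> sets \<mu>" using A by (rule measurable_sets)
    moreover have "A \<subseteq> carrier G" using sets.sets_into_space[OF A] by (simp add: sp)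
    then have "(\<lambda>y. inv x \<otimes> y) -` A \<inter> space \<mu> = x <# A"
      using l_coset_vimage[OF x] by (auto simp: sp)
    ultimately show ?thesis by simp
  qed
  \<comment> \<open>An open \<open>U\<close> around \<open>A\<close> gives the open set
    \<open>x <# U\<close> around \<open>x <# A\<close>; \<open>open_le\<close> for
    \<open>inv x\<close> carries its measure back to that of \<open>U\<close>.\<close>
  have le: "emeasure \<mu> (x <# A) \<le> emeasure \<mu> A" if x: "x \<in> carrier G" and A: "A \<in> sets \<mu>" for x A
    unfolding outer[OF A]
  proof (rule INF_greatest)
    fix U assume "U \<in> {U. openin T U \<and> A \<subseteq> U}"
    then have U: "openin T U" "A \<subseteq> U" by auto
    have "emeasure \<mu> (x <# A) \<le> emeasure \<mu> (x <# U)"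
      using U openin_l_coset[OF x U(1)]
      by (intro emeasure_mono) (auto simp: se borel_sets_of_def l_coset_image)
    also have "\<dots> \<le> emeasure \<mu> (inv x <# (x <# U))"
      by (rule open_le) (use x openin_l_coset[OF x U(1)] in auto)
    also have "\<dots> = emeasure \<mu> U"
      using l_coset_inv_cancel[OF x openin_subset_carrier[OF U(1)]] by simp
    finally show "emeasure \<mu> (x <# A) \<le> emeasure \<mu> U" .
  qed
  have "emeasure \<mu> (x <# A) = emeasure \<mu> A" if x: "x \<in> carrier G" and A: "A \<in> sets \<mu>" for x A
  proof (rule antisym[OF le[OF x A]])
    have "A \<subseteq> carrier G" using sets.sets_into_space[OF A] by (simp add: sp)
    then show "emeasure \<mu> A \<le> emeasure \<mu> (x <# A)"
      using le[of "inv x" "x <# A"] sets_l_coset[OF x A] x l_coset_inv_cancel[OF x] by simp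
  qed
  then show ?thesis using \<mu> nz by (auto simp: left_haar_measure_def)
qed

end

section \<open>Positive functionals on compactly supported functions\<close>

lemma compactly_supportedI:
  assumes "Hausdorff_space T" "continuous_map T euclideanreal f" "compactin T K"
    "\<And>x. x \<in> topspace T \<Longrightarrow> x \<notin> K \<Longrightarrow> f x = 0"
  shows "f \<in> compactly_supported T"
proof -
  have "T closure_of {x \<in> topspace T. f x \<noteq> 0} \<subseteq> K"
    using assms by (intro closure_of_minimal compactin_imp_closedin) auto
  then show ?thesis
    unfolding compactly_supported_def using assms(2,3) closed_compactin closedin_closure_of by blast
qed

lemma compactly_supportedE:
  assumes "f \<in> compactly_supported T"
  obtains K where "continuous_map T euclideanreal f" "compactin T K"
    "\<And>x. x \<in> topspace T \<Longrightarrow> x \<notin> K \<Longrightarrow> f x = 0"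
proof (rule that)
  let ?S = "{x \<in> topspace T. f x \<noteq> 0}"
  show "continuous_map T euclideanreal f" "compactin T (T closure_of ?S)"
    using assms by (auto simp: compactly_supported_def)
  have "?S \<subseteq> T closure_of ?S" by (rule closure_of_subset) auto
  then show "f x = 0" if "x \<in> topspace T" "x \<notin> T closure_of ?S" for x
    using that by blast
qed

lemma compactly_supported_continuous: "f \<in> compactly_supported T \<Longrightarrow> continuous_map T euclideanreal f"
  by (simp add: compactly_supported_def)

lemma compactly_supported_add:
  assumes T: "Hausdorff_space T" and f: "f \<in> compactly_supported T" and g: "g \<in> compactly_supported T"
  shows "(\<lambda>x. f x + g x) \<in> compactly_supported T"
proof -
  obtain K where K: "continuous_map T euclideanreal f" "compactin T K"
    "\<And>x. x \<in> topspace T \<Longrightarrow> x \<notin> K \<Longrightarrow> f x = 0" using f by (rule compactly_supportedE) blast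
  obtain L where L: "continuous_map T euclideanreal g" "compactin T L"
    "\<And>x. x \<in> topspace T \<Longrightarrow> x \<notin> L \<Longrightarrow> g x = 0" using g by (rule compactly_supportedE) blast
  show ?thesis
    by (rule compactly_supportedI[OF T, of _ "K \<union> L"])
      (use K L in \<open>auto intro!: continuous_map_add compactin_Un\<close>)
qed

lemma compactly_supported_mult_right:
  assumes T: "Hausdorff_space T" and f: "f \<in> compactly_supported T"
    and g: "continuous_map T euclideanreal g"
  shows "(\<lambda>x. g x * f x) \<in> compactly_supported T"
proof -
  obtain K where K: "continuous_map T euclideanreal f" "compactin T K"
    "\<And>x. x \<in> topspace T \<Longrightarrow> x \<notin> K \<Longrightarrow> f x = 0" using f by (rule compactly_supportedE) blast
  show ?thesis
    by (rule compactly_supportedI[OF T, of _ K])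
      (use K g in \<open>auto intro!: continuous_map_real_mult\<close>)
qed

lemma compactly_supported_scale:
  "Hausdorff_space T \<Longrightarrow> f \<in> compactly_supported T \<Longrightarrow> (\<lambda>x. c * f x) \<in> compactly_supported T"
  by (rule compactly_supported_mult_right) auto

lemma compactly_supported_diff:
  assumes "Hausdorff_space T" "f \<in> compactly_supported T" "g \<in> compactly_supported T"
  shows "(\<lambda>x. f x - g x) \<in> compactly_supported T"
  using compactly_supported_add[OF assms(1,2) compactly_supported_scale[OF assms(1,3), of "-1"]] by simp

text \<open>Urysohn's lemma separates \<open>K\<close> from the complement of an open
  \<open>U\<close> that lies between \<open>K\<close> and a compact set; the resulting function is 0
  on \<open>K\<close>, so its complement to 1 is taken.\<close>

lemma compactly_supported_cutoff:
  assumes "Hausdorff_space T" "locally_compact_space T" "compactin T K"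
  obtains \<psi> where "\<psi> \<in> compactly_supported T" "\<And>x. x \<in> topspace T \<Longrightarrow> 0 \<le> \<psi> x" "\<And>x. x \<in> K \<Longrightarrow> \<psi> x = 1"
proof -
  obtain U L where UL: "openin T U" "compactin T L" "K \<subseteq> U" "U \<subseteq> L"
    using locally_compact_space_compact_closed_compact[of T] assms by metis
  have "completely_regular_space T"
    using locally_compact_regular_imp_completely_regular_space assms by blast
  moreover have "closedin T (topspace T - U)" using UL by blast
  moreover have "disjnt (topspace T - U) K" using UL by (auto simp: disjnt_def)
  ultimately obtain f where f: "continuous_map T (subtopology euclidean {0..1::real}) f"
      "f ` K \<subseteq> {0}" "f ` (topspace T - U) \<subseteq> {1}"
    using Urysohn_completely_regular_closed_compact[of 0 1 T "topspace T - U" K] assms(3) by auto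
  show thesis
  proof (rule that[of "\<lambda>x. 1 - f x"])
    show "(\<lambda>x. 1 - f x) \<in> compactly_supported T"
    proof (rule compactly_supportedI[OF assms(1) _ UL(2)])
      show "continuous_map T euclideanreal (\<lambda>x. 1 - f x)"
        using f(1) by (auto intro!: continuous_map_diff simp: continuous_map_in_subtopology)
      show "1 - f x = 0" if "x \<in> topspace T" "x \<notin> L" for x
      proof -
        have "x \<in> topspace T - U" using that UL(4) by blast
        then show ?thesis using f(3) by auto
      qed
    qed
    show "0 \<le> 1 - f x" if "x \<in> topspace T" for x
      using f(1) that by (auto simp: continuous_map_in_subtopology)
    show "1 - f x = 1" if "x \<in> K" for x using f(2) that by auto
  qed
qed

definition positive_functional :: "'a topology \<Rightarrow> (('a \<Rightarrow> real) \<Rightarrow> real) \<Rightarrow> bool" where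
  "positive_functional T J \<longleftrightarrow>
     (\<forall>f\<in>compactly_supported T. \<forall>g\<in>compactly_supported T. J (\<lambda>x. f x + g x) = J f + J g) \<and>
     (\<forall>f\<in>compactly_supported T. \<forall>c. J (\<lambda>x. c * f x) = c * J f) \<and>
     (\<forall>f\<in>compactly_supported T. (\<forall>x\<in>topspace T. 0 \<le> f x) \<longrightarrow> 0 \<le> J f)"

locale positive_functional_on =
  fixes T :: "'a topology" and J :: "('a \<Rightarrow> real) \<Rightarrow> real"
  assumes T2: "Hausdorff_space T" and lc: "locally_compact_space T"
    and pf: "positive_functional T J"
begin

lemma functional_add:
  "f \<in> compactly_supported T \<Longrightarrow> g \<in> compactly_supported T \<Longrightarrow> J (\<lambda>x. f x + g x) = J f + J g"
  using pf by (simp add: positive_functional_def)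

lemma functional_scale: "f \<in> compactly_supported T \<Longrightarrow> J (\<lambda>x. c * f x) = c * J f"
  using pf by (simp add: positive_functional_def)

lemma functional_nonneg:
  "f \<in> compactly_supported T \<Longrightarrow> (\<And>x. x \<in> topspace T \<Longrightarrow> 0 \<le> f x) \<Longrightarrow> 0 \<le> J f"
  using pf by (simp add: positive_functional_def)

lemma functional_diff:
  assumes "f \<in> compactly_supported T" "g \<in> compactly_supported T"
  shows "J (\<lambda>x. f x - g x) = J f - J g"
  using functional_add[OF assms(1) compactly_supported_scale[OF T2 assms(2), of "-1"]]
    functional_scale[OF assms(2), of "-1"] by simp

lemma functional_mono:
  assumes "f \<in> compactly_supported T" "g \<in> compactly_supported T" "\<And>x. x \<in> topspace T \<Longrightarrow> f x \<le> g x"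
  shows "J f \<le> J g"
  using functional_nonneg[OF compactly_supported_diff[OF T2 assms(2,1)]] functional_diff[OF assms(2,1)] assms(3)
  by simp

lemma functional_cong:
  assumes "f \<in> compactly_supported T" "g \<in> compactly_supported T" "\<And>x. x \<in> topspace T \<Longrightarrow> f x = g x"
  shows "J f = J g"
  using functional_mono[OF assms(1,2)] functional_mono[OF assms(2,1)] assms(3) by fastforce

text \<open>With a cutoff function as \<psi>, a uniform estimate on a compact set becomes an
  estimate for \<open>J\<close>. This replaces the finite mass of the compact set that a measure
  would supply.\<close>

lemma functional_abs_diff_le:
  assumes "f \<in> compactly_supported T" "g \<in> compactly_supported T" "\<psi> \<in> compactly_supported T"
    "\<And>x. x \<in> topspace T \<Longrightarrow> \<bar>f x - g x\<bar> \<le> e * \<psi> x"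
  shows "\<bar>J f - J g\<bar> \<le> e * J \<psi>"
proof -
  note e\<psi> = compactly_supported_scale[OF T2 assms(3), of e]
  have bounds: "f x - g x \<le> e * \<psi> x" "g x - f x \<le> e * \<psi> x" if "x \<in> topspace T" for x
    using assms(4)[OF that] by auto
  have "J (\<lambda>x. f x - g x) \<le> J (\<lambda>x. e * \<psi> x)"
    by (rule functional_mono) (use assms e\<psi> compactly_supported_diff[OF T2] bounds in auto)
  moreover have "J (\<lambda>x. g x - f x) \<le> J (\<lambda>x. e * \<psi> x)"
    by (rule functional_mono) (use assms e\<psi> compactly_supported_diff[OF T2] bounds in auto)
  ultimately show ?thesis
    using functional_diff assms(1,2) functional_scale[OF assms(3), of e] by (simp add: abs_le_iff)
qed

end

section \<open>Continuous dependence on a parameter\<close>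

text \<open>Uniformity in \<open>y\<close> comes from the tube lemma, applied to the open set of
  pairs at which \<open>F\<close> differs by less than \<open>e\<close> from its value on the fibre
  over \<open>x\<close>.\<close>

lemma continuous_map_tube:
  assumes F: "continuous_map (prod_topology X Y) euclideanreal (\<lambda>(x, y). F x y)"
    and L: "compactin Y L" and x: "x \<in> topspace X" and e: "0 < (e::real)"
  obtains U where "openin X U" "x \<in> U" "\<And>x' y. x' \<in> U \<Longrightarrow> y \<in> L \<Longrightarrow> \<bar>F x' y - F x y\<bar> < e"
proof -
  let ?Z = "prod_topology X Y"
  have F': "continuous_map ?Z euclideanreal (\<lambda>p. F (fst p) (snd p))"
    using F by (simp add: case_prod_unfold)
  have "continuous_map ?Z ?Z (\<lambda>p. (x, snd p))"
    using x by (auto intro!: continuous_map_pairedI continuous_map_snd)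
  from continuous_map_compose[OF this F'] have "continuous_map ?Z euclideanreal (\<lambda>p. F x (snd p))"
    by (simp add: o_def)
  then have "continuous_map ?Z euclideanreal (\<lambda>p. F (fst p) (snd p) - F x (snd p))"
    using F' by (intro continuous_map_diff)
  then have W: "openin ?Z {p \<in> topspace ?Z. F (fst p) (snd p) - F x (snd p) \<in> {-e<..<e}}" (is "openin _ ?W")
    by (rule openin_continuous_map_preimage) simp
  have "{x} \<times> L \<subseteq> ?W" using x e compactin_subset_topspace[OF L] by auto
  then obtain U V where UV: "openin X U" "x \<in> U" "L \<subseteq> V" "U \<times> V \<subseteq> ?W"
    using tube_lemma_right[OF W L x] by blast
  show thesis
  proof (rule that[OF UV(1,2)])
    fix x' y assume "x' \<in> U" "y \<in> L"
    then have "(x', y) \<in> ?W" using UV by blast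
    then show "\<bar>F x' y - F x y\<bar> < e" by (auto simp: abs_less_iff)
  qed
qed

lemma continuous_map_section:
  assumes "continuous_map (prod_topology X Y) Z (\<lambda>(x, y). F x y)" "x \<in> topspace X"
  shows "continuous_map Y Z (F x)"
proof -
  have "continuous_map Y (prod_topology X Y) (\<lambda>y. (x, y))"
    using assms(2) by (auto intro!: continuous_map_pairedI)
  from continuous_map_compose[OF this assms(1)] show ?thesis by (simp add: o_def)
qed

lemma continuous_map_real_iff:
  "continuous_map X euclideanreal f \<longleftrightarrow>
   (\<forall>x\<in>topspace X. \<forall>e>0. \<exists>U. openin X U \<and> x \<in> U \<and> (\<forall>x'\<in>U. \<bar>f x' - f x\<bar> < e))"
  using Met_TC.continuous_map_to_metric[of X f]
  by (simp add: dist_real_def abs_minus_commute)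

text \<open>The supports must stay in one compact set near each parameter value: then a single
  cutoff function turns uniform closeness of the sections into closeness of their values under
  \<open>J\<close>.\<close>

lemma (in positive_functional_on) continuous_map_functional:
  assumes F: "continuous_map (prod_topology X T) euclideanreal (\<lambda>(x, y). F x y)"
    and supp: "\<And>x. x \<in> topspace X \<Longrightarrow> \<exists>U L. openin X U \<and> x \<in> U \<and> compactin T L \<and>
       (\<forall>x'\<in>U. \<forall>y\<in>topspace T - L. F x' y = 0)"
  shows "continuous_map X euclideanreal (\<lambda>x. J (F x))"
  unfolding continuous_map_real_iff
proof (intro ballI allI impI)
  fix x and e :: real assume x: "x \<in> topspace X" and e: "0 < e"
  have Cc: "F x' \<in> compactly_supported T" if "x' \<in> topspace X" for x'
  proof -
    obtain U L where "openin X U" "x' \<in> U" "compactin T L" "\<forall>x'\<in>U. \<forall>y\<in>topspace T - L. F x' y = 0"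
      using supp[OF \<open>x' \<in> topspace X\<close>] by metis
    then show ?thesis
      by (intro compactly_supportedI[OF T2, of _ L] continuous_map_section[OF F] that) auto
  qed
  obtain U L where UL: "openin X U" "x \<in> U" "compactin T L" "\<forall>x'\<in>U. \<forall>y\<in>topspace T - L. F x' y = 0"
    using supp[OF x] by metis
  obtain \<psi> where \<psi>: "\<psi> \<in> compactly_supported T" "\<And>y. y \<in> topspace T \<Longrightarrow> 0 \<le> \<psi> y"
      "\<And>y. y \<in> L \<Longrightarrow> \<psi> y = 1"
    using compactly_supported_cutoff[OF T2 lc UL(3)] by metis
  \<comment> \<open>\<open>J \<psi>\<close> may be 0; adding 1 keeps the quotient defined and makes
    the final inequality strict.\<close>
  define d where "d = e / (J \<psi> + 1)"
  have J\<psi>: "0 \<le> J \<psi>" using functional_nonneg \<psi> by blast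
  have d: "0 < d" using e J\<psi> by (simp add: d_def)
  obtain V where V: "openin X V" "x \<in> V" "\<And>x' y. x' \<in> V \<Longrightarrow> y \<in> L \<Longrightarrow> \<bar>F x' y - F x y\<bar> < d"
    using continuous_map_tube[OF F UL(3) x d] by metis
  have "\<bar>J (F x') - J (F x)\<bar> < e" if x': "x' \<in> U \<inter> V" for x'
  proof -
    have x'X: "x' \<in> topspace X" using x' UL(1) openin_subset by blast
    have "\<bar>J (F x') - J (F x)\<bar> \<le> d * J \<psi>"
    proof (rule functional_abs_diff_le[OF Cc[OF x'X] Cc[OF x] \<psi>(1)])
      fix y assume y: "y \<in> topspace T"
      show "\<bar>F x' y - F x y\<bar> \<le> d * \<psi> y"
      proof (cases "y \<in> L")
        case True
        then show ?thesis using V(3)[of x' y] x' \<psi>(3) by auto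
      next
        case False
        then show ?thesis using UL(2,4) x' y \<psi>(2) d by simp
      qed
    qed
    also have "d * J \<psi> < e" using e J\<psi> by (simp add: d_def field_simps)
    finally show ?thesis .
  qed
  then show "\<exists>U. openin X U \<and> x \<in> U \<and> (\<forall>x'\<in>U. \<bar>J (F x') - J (F x)\<bar> < e)"
    using UL V by (intro exI[of _ "U \<inter> V"]) auto
qed

section \<open>Integration against Radon measures\<close>

locale radon =
  fixes T :: "'a topology" and \<mu> :: "'a measure"
  assumes T2: "Hausdorff_space T" and lc: "locally_compact_space T"
    and rm: "radon_measure T \<mu>"
begin

lemma space_eq: "space \<mu> = topspace T" and sets_eq: "sets \<mu> = borel_sets_of T"
  using rm by (auto simp: radon_measure_def)

lemma sets_openin: "openin T U \<Longrightarrow> U \<in> sets \<mu>"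
  by (simp add: sets_eq borel_sets_of_def)

lemma sets_closedin: "closedin T C \<Longrightarrow> C \<in> sets \<mu>"
proof -
  assume "closedin T C"
  then have "C = space \<mu> - (topspace T - C)" "openin T (topspace T - C)"
    using closedin_subset by (auto simp: space_eq)
  then show ?thesis using sets_openin sets.compl_sets by metis
qed

lemma sets_compactin: "compactin T K \<Longrightarrow> K \<in> sets \<mu>"
  using sets_closedin compactin_imp_closedin[OF T2] by blast

lemma emeasure_compactin: "compactin T K \<Longrightarrow> emeasure \<mu> K < \<infinity>"
  using rm by (auto simp: radon_measure_def)

lemma borel_measurable_continuous:
  assumes "continuous_map T euclideanreal f"
  shows "f \<in> borel_measurable \<mu>"
proof (rule borel_measurableI)
  fix S :: "real set" assume "open S"
  then have "openin T {x \<in> topspace T. f x \<in> S}"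
    using assms openin_continuous_map_preimage by fastforce
  moreover have "f -` S \<inter> space \<mu> = {x \<in> topspace T. f x \<in> S}" by (auto simp: space_eq)
  ultimately show "f -` S \<inter> space \<mu> \<in> sets \<mu>" using sets_openin by simp
qed

lemma integrable_compactly_supported:
  assumes f: "f \<in> compactly_supported T"
  shows "integrable \<mu> f"
proof -
  obtain K where K: "continuous_map T euclideanreal f" "compactin T K"
    "\<And>x. x \<in> topspace T \<Longrightarrow> x \<notin> K \<Longrightarrow> f x = 0" using f by (rule compactly_supportedE) blast
  have "compact (f ` K)" using image_compactin[OF K(2,1)] by simp
  then obtain B where B: "\<And>x. x \<in> K \<Longrightarrow> norm (f x) \<le> B"
    using compact_imp_bounded bounded_iff by (metis imageI)
  show ?thesis
    by (rule integrableI_bounded_set[of K _ _ B])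
      (use K B sets_compactin borel_measurable_continuous emeasure_compactin in \<open>auto simp: space_eq\<close>)
qed

lemma integrable_indicator_compactly_supported:
  assumes f: "f \<in> compactly_supported T" and B: "B \<in> sets \<mu>"
  shows "integrable \<mu> (\<lambda>x. indicator B x * f x)"
  using integrable_mult_indicator[OF B integrable_compactly_supported[OF f]] by simp

text \<open>Integration over a Borel piece is again a positive functional, so the results on
  continuity in a parameter apply to partial integrals over \<open>B\<close>.\<close>

lemma positive_functional_indicator:
  assumes B: "B \<in> sets \<mu>"
  shows "positive_functional_on T (\<lambda>f. LINT x|\<mu>. indicator B x * f x)"
proof
  note int = integrable_indicator_compactly_supported[OF _ B]
  show "positive_functional T (\<lambda>f. LINT x|\<mu>. indicator B x * f x)"
    unfolding positive_functional_def
  proof (intro conjI ballI allI impI)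
    fix f g assume "f \<in> compactly_supported T" "g \<in> compactly_supported T"
    then show "(LINT x|\<mu>. indicator B x * (f x + g x)) =
        (LINT x|\<mu>. indicator B x * f x) + (LINT x|\<mu>. indicator B x * g x)"
      using int by (simp add: distrib_left)
  next
    fix f :: "'a \<Rightarrow> real" and c
    have "(LINT x|\<mu>. indicator B x * (c * f x)) = (LINT x|\<mu>. c * (indicator B x * f x))"
      by (simp add: ac_simps)
    then show "(LINT x|\<mu>. indicator B x * (c * f x)) = c * (LINT x|\<mu>. indicator B x * f x)" by simp
  next
    fix f :: "'a \<Rightarrow> real" assume "\<forall>x\<in>topspace T. 0 \<le> f x"
    then show "0 \<le> (LINT x|\<mu>. indicator B x * f x)"
      by (intro Bochner_Integration.integral_nonneg) (auto simp: space_eq)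
  qed
qed (rule T2 lc)+

lemma positive_functional_integral: "positive_functional_on T (\<lambda>f. LINT x|\<mu>. f x)"
proof
  note int = integrable_compactly_supported
  show "positive_functional T (\<lambda>f. LINT x|\<mu>. f x)"
    unfolding positive_functional_def using int
    by (auto intro!: Bochner_Integration.integral_nonneg simp: space_eq)
qed (rule T2 lc)+

end

text \<open>Fubini for a Radon measure and a positive functional: on a small piece \<open>B\<close> of \<open>K\<close> the
  integrand hardly depends on \<open>x\<close>, and both iterated integrals are additive in \<open>B\<close>.\<close>

lemma functional_integral_commute:
  assumes "radon X \<mu>" and "positive_functional_on Y J"
    and F: "continuous_map (prod_topology X Y) euclideanreal (\<lambda>(x, y). F x y)"
    and K: "compactin X K" and L: "compactin Y L"
    and supp: "\<And>x y. x \<in> topspace X \<Longrightarrow> y \<in> topspace Y \<Longrightarrow> x \<notin> K \<or> y \<notin> L \<Longrightarrow> F x y = 0"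
  shows "J (\<lambda>y. LINT x|\<mu>. F x y) = (LINT x|\<mu>. J (F x))"
proof -
  interpret X: radon X \<mu> by fact
  interpret Y: positive_functional_on Y J by fact
  have Ksets: "K \<in> sets \<mu>" using X.sets_compactin K .
  have Kfin: "emeasure \<mu> K < \<infinity>" using X.emeasure_compactin K .
  have FCc: "F x \<in> compactly_supported Y" if "x \<in> topspace X" for x
    using that L supp by (intro compactly_supportedI[OF Y.T2 _ L] continuous_map_section[OF F]) auto
  have F_swap: "continuous_map (prod_topology Y X) euclideanreal (\<lambda>(y, x). F x y)"
    using continuous_map_compose[OF continuous_map_pairedI[OF continuous_map_snd continuous_map_fst] F]
    by (simp add: case_prod_unfold o_def)
  have FCc': "(\<lambda>x. F x y) \<in> compactly_supported X" if "y \<in> topspace Y" for y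
    using that K supp
    by (intro compactly_supportedI[OF X.T2 _ K] continuous_map_section[OF F_swap]) auto
  have JF: "(\<lambda>x. J (F x)) \<in> compactly_supported X"
  proof (rule compactly_supportedI[OF X.T2 _ K])
    show "continuous_map X euclideanreal (\<lambda>x. J (F x))"
    proof (rule Y.continuous_map_functional[OF F])
      fix x assume "x \<in> topspace X"
      then show "\<exists>U L. openin X U \<and> x \<in> U \<and> compactin Y L \<and> (\<forall>x'\<in>U. \<forall>y\<in>topspace Y - L. F x' y = 0)"
        using L supp by (intro exI[of _ "topspace X"] exI[of _ L]) auto
    qed
    fix x assume x: "x \<in> topspace X" "x \<notin> K"
    \<comment> \<open>\<open>F x\<close> vanishes on \<open>topspace Y\<close> but perhaps not off
      it, so it is first exchanged for a genuine zero function.\<close>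
    have "J (F x) = J (\<lambda>y. 0 * F x y)"
      by (rule Y.functional_cong) (use FCc x supp compactly_supported_scale[OF Y.T2 FCc[OF x(1)], of 0] in auto)
    then show "J (F x) = 0" using Y.functional_scale[OF FCc[OF x(1)], of 0] by simp
  qed
  obtain \<psi> where \<psi>: "\<psi> \<in> compactly_supported Y" "\<And>y. y \<in> topspace Y \<Longrightarrow> 0 \<le> \<psi> y"
      "\<And>y. y \<in> L \<Longrightarrow> \<psi> y = 1"
    using compactly_supported_cutoff[OF Y.T2 Y.lc L] by metis
  have J\<psi>: "0 \<le> J \<psi>" using Y.functional_nonneg \<psi> by blast
  \<comment> \<open>\<open>I B\<close> and \<open>H B\<close> are the inner integral for one order
    of integration and the full integral for the other, both restricted to a Borel piece
    \<open>B\<close>. The claim is that \<open>J (I K)\<close> equals \<open>H K\<close>.\<close>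
  define I where "I B y = (LINT x|\<mu>. indicator B x * F x y)" for B y
  define H where "H B = (LINT x|\<mu>. indicator B x * J (F x))" for B
  have ICc: "I B \<in> compactly_supported Y" if B: "B \<in> sets \<mu>" for B
  proof (rule compactly_supportedI[OF Y.T2 _ L])
    interpret B: positive_functional_on X "\<lambda>f. LINT x|\<mu>. indicator B x * f x"
      by (rule X.positive_functional_indicator[OF B])
    show "continuous_map Y euclideanreal (I B)"
      unfolding I_def[abs_def]
    proof (rule B.continuous_map_functional[OF F_swap])
      fix y assume "y \<in> topspace Y"
      then show "\<exists>U L. openin Y U \<and> y \<in> U \<and> compactin X L \<and> (\<forall>y'\<in>U. \<forall>x\<in>topspace X - L. F x y' = 0)"
        using K supp by (intro exI[of _ "topspace Y"] exI[of _ K]) auto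
    qed
    fix y assume "y \<in> topspace Y" "y \<notin> L"
    then have "I B y = (LINT x|\<mu>. 0)"
      unfolding I_def by (intro Bochner_Integration.integral_cong) (auto simp: supp X.space_eq)
    then show "I B y = 0" by simp
  qed
  \<comment> \<open>The error is proportional to the measure of the piece. It therefore adds up to a
    bound that does not depend on how many pieces the partition needs.\<close>
  have est: "\<bar>J (I K) - H K\<bar> \<le> 2 * e * measure \<mu> K * J \<psi>" if e: "0 < e" for e
  proof -
    define U where "U = (\<lambda>x. SOME U. openin X U \<and> x \<in> U \<and> (\<forall>x'\<in>U. \<forall>y\<in>L. \<bar>F x' y - F x y\<bar> < e))"
    have U: "openin X (U x)" "x \<in> U x" "\<And>x' y. x' \<in> U x \<Longrightarrow> y \<in> L \<Longrightarrow> \<bar>F x' y - F x y\<bar> < e"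
      if x: "x \<in> topspace X" for x
    proof -
      have "\<exists>U. openin X U \<and> x \<in> U \<and> (\<forall>x'\<in>U. \<forall>y\<in>L. \<bar>F x' y - F x y\<bar> < e)"
        using continuous_map_tube[OF F L x e] by metis
      then have "openin X (U x) \<and> x \<in> U x \<and> (\<forall>x'\<in>U x. \<forall>y\<in>L. \<bar>F x' y - F x y\<bar> < e)"
        unfolding U_def by (rule someI_ex)
      then show "openin X (U x)" "x \<in> U x" "\<And>x' y. x' \<in> U x \<Longrightarrow> y \<in> L \<Longrightarrow> \<bar>F x' y - F x y\<bar> < e"
        by auto
    qed
    have UF: "\<bar>F x' y - F x y\<bar> \<le> e * \<psi> y" if "x \<in> topspace X" "x' \<in> U x" "y \<in> topspace Y" for x x' y
    proof (cases "y \<in> L")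
      case True
      then show ?thesis using U(3)[OF that(1,2) True] \<psi>(3) by simp
    next
      case False
      have "x' \<in> topspace X" using U(1)[OF that(1)] that(2) openin_subset by blast
      then show ?thesis using that False supp \<psi>(2) e by simp
    qed
    \<comment> \<open>On a piece where \<open>F\<close> is nearly \<open>F x\<close>, both
      quantities are close to \<open>measure \<mu> B * J (F x)\<close>.\<close>
    have small: "\<bar>J (I B) - H B\<bar> \<le> 2 * e * measure \<mu> B * J \<psi>"
      if B: "B \<in> sets \<mu>" "B \<subseteq> K" and x: "x \<in> topspace X" and BU: "B \<subseteq> U x" for B x
    proof -
      have Bfin: "emeasure \<mu> B < \<infinity>"
        using emeasure_mono[OF B(2) Ksets] Kfin by (rule le_less_trans)
      have intB: "integrable \<mu> (\<lambda>x. indicator B x * c)" for c :: real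
        using Bfin B(1) by (intro integrable_mult_left) (auto simp: integrable_indicator_iff less_top)
      \<comment> \<open>Used twice: for the functions \<open>\<lambda>t. F t y\<close> near the
        constant \<open>F x y\<close>, and for \<open>\<lambda>t. J (F t)\<close> near
        \<open>J (F x)\<close>.\<close>
      have approx: "\<bar>(LINT t|\<mu>. indicator B t * f t) - measure \<mu> B * a\<bar> \<le> measure \<mu> B * d"
        if f: "f \<in> compactly_supported X" and fa: "\<And>t. t \<in> B \<Longrightarrow> \<bar>f t - a\<bar> \<le> d" for f a d
      proof -
        note intf = X.integrable_indicator_compactly_supported[OF f B(1)]
        have "(LINT t|\<mu>. indicator B t * f t) - measure \<mu> B * a
            = (LINT t|\<mu>. indicator B t * f t) - (LINT t|\<mu>. indicator B t * a)"
          using B(1) Bfin by simp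
        also have "\<dots> = (LINT t|\<mu>. indicator B t * f t - indicator B t * a)"
          using intf intB by simp
        also have "\<bar>\<dots>\<bar> \<le> (LINT t|\<mu>. indicator B t * d)"
        proof (rule order_trans[OF Bochner_Integration.integral_abs_bound Bochner_Integration.integral_mono])
          show "integrable \<mu> (\<lambda>t. \<bar>indicator B t * f t - indicator B t * a\<bar>)"
            using intf intB by (intro integrable_abs Bochner_Integration.integrable_diff)
          show "\<bar>indicator B t * f t - indicator B t * a\<bar> \<le> indicator B t * d" for t
            using fa by (auto simp: indicator_def)
        qed (rule intB)
        also have "\<dots> = measure \<mu> B * d" using B(1) Bfin by simp
        finally show ?thesis .
      qed
      have 1: "\<bar>I B y - measure \<mu> B * F x y\<bar> \<le> (measure \<mu> B * e) * \<psi> y" if y: "y \<in> topspace Y" for y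
        using approx[OF FCc'[OF y], of "F x y" "e * \<psi> y"] UF[OF x _ y] BU
        unfolding I_def by (auto simp: mult.assoc)
      have 2: "\<bar>J (I B) - J (\<lambda>y. measure \<mu> B * F x y)\<bar> \<le> (measure \<mu> B * e) * J \<psi>"
        by (rule Y.functional_abs_diff_le[OF ICc[OF B(1)] _ \<psi>(1) 1])
          (rule compactly_supported_scale[OF Y.T2 FCc[OF x]])
      have 3: "\<bar>J (F t) - J (F x)\<bar> \<le> e * J \<psi>" if "t \<in> B" for t
        using that BU UF[OF x] B(2) compactin_subset_topspace[OF K]
        by (intro Y.functional_abs_diff_le FCc \<psi> x) auto
      have 4: "\<bar>H B - measure \<mu> B * J (F x)\<bar> \<le> measure \<mu> B * (e * J \<psi>)"
        unfolding H_def by (rule approx[OF JF 3])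
      show ?thesis
        using 2 4 Y.functional_scale[OF FCc[OF x], of "measure \<mu> B"] by (simp add: algebra_simps)
    qed
    \<comment> \<open>Induction on the finite subcover: each step cuts off the part of
      \<open>B\<close> inside one \<open>U x\<close> and leaves the rest to the remaining
      sets.\<close>
    have all: "\<forall>B\<in>sets \<mu>. B \<subseteq> K \<and> B \<subseteq> (\<Union>x\<in>D. U x) \<longrightarrow> \<bar>J (I B) - H B\<bar> \<le> 2 * e * measure \<mu> B * J \<psi>"
      if "finite D" "D \<subseteq> topspace X" for D
      using that
    proof (induction D rule: finite_induct)
      case empty
      have "I {} = (\<lambda>y. 0 * \<psi> y)" "H {} = 0" by (auto simp: I_def H_def)
      then show ?case using Y.functional_scale[OF \<psi>(1), of 0] by simp
    next
      case (insert x D)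
      show ?case
      proof (intro ballI impI, elim conjE)
        fix B assume B: "B \<in> sets \<mu>" "B \<subseteq> K" "B \<subseteq> (\<Union>x\<in>insert x D. U x)"
        have x: "x \<in> topspace X" using insert by simp
        have Us: "U x \<in> sets \<mu>" using X.sets_openin U(1)[OF x] .
        define B1 B2 where "B1 = B \<inter> U x" and "B2 = B - U x"
        have B12: "B1 \<in> sets \<mu>" "B2 \<in> sets \<mu>" "B1 \<subseteq> K" "B2 \<subseteq> K" "B1 \<subseteq> U x" "B2 \<subseteq> (\<Union>x\<in>D. U x)"
          using B Us by (auto simp: B1_def B2_def)
        have dis: "B = B1 \<union> B2" "B1 \<inter> B2 = {}" by (auto simp: B1_def B2_def)
        have ind: "indicator B t = (indicator B1 t + indicator B2 t :: real)" for t
          using dis by (auto simp: indicator_def)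
        have "I B y = I B1 y + I B2 y" if "y \<in> topspace Y" for y
          unfolding I_def ind distrib_right
          by (intro Bochner_Integration.integral_add X.integrable_indicator_compactly_supported FCc' that B12)
        then have "J (I B) = J (\<lambda>y. I B1 y + I B2 y)"
          using ICc B B12 by (intro Y.functional_cong compactly_supported_add[OF Y.T2]) auto
        also have "\<dots> = J (I B1) + J (I B2)" using ICc B12 by (intro Y.functional_add) auto
        finally have JI: "J (I B) = J (I B1) + J (I B2)" .
        have HH: "H B = H B1 + H B2"
          unfolding H_def ind distrib_right
          by (intro Bochner_Integration.integral_add X.integrable_indicator_compactly_supported JF B12)
        have "emeasure \<mu> B1 \<noteq> \<infinity>" "emeasure \<mu> B2 \<noteq> \<infinity>"
          using emeasure_mono[OF B12(3) Ksets] emeasure_mono[OF B12(4) Ksets] Kfin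
          by (auto simp: top_unique)
        then have "measure \<mu> B = measure \<mu> B1 + measure \<mu> B2"
          unfolding dis(1) using B12 dis(2) by (intro measure_Union) auto
        moreover have "\<bar>J (I B1) - H B1\<bar> \<le> 2 * e * measure \<mu> B1 * J \<psi>"
          by (rule small[OF B12(1,3) x B12(5)])
        moreover have "\<bar>J (I B2) - H B2\<bar> \<le> 2 * e * measure \<mu> B2 * J \<psi>"
          using insert B12 by auto
        ultimately show "\<bar>J (I B) - H B\<bar> \<le> 2 * e * measure \<mu> B * J \<psi>"
          using JI HH by (simp add: algebra_simps)
      qed
    qed
    have KX: "K \<subseteq> topspace X" using compactin_subset_topspace[OF K] .
    have "K \<subseteq> \<Union>(U ` K)" using U(2) KX by blast
    moreover have "\<And>V. V \<in> U ` K \<Longrightarrow> openin X V" using U(1) KX by blast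
    ultimately obtain \<F> where "finite \<F>" "\<F> \<subseteq> U ` K" "K \<subseteq> \<Union>\<F>"
      using compactinD[OF K] by metis
    then obtain D where "D \<subseteq> K" "finite D" "K \<subseteq> (\<Union>x\<in>D. U x)" by (metis finite_subset_image)
    then show ?thesis using all[of D] KX Ksets by auto
  qed
  have "\<bar>J (I K) - H K\<bar> \<le> 0"
  proof (rule field_le_epsilon)
    fix e :: real assume e: "0 < e"
    define d where "d = e / (2 * measure \<mu> K * J \<psi> + 1)"
    have nn: "0 \<le> 2 * measure \<mu> K * J \<psi>" using J\<psi> by simp
    have "\<bar>J (I K) - H K\<bar> \<le> d * (2 * measure \<mu> K * J \<psi>)"
      using est[of d] e nn by (simp add: d_def mult_ac)
    also have "\<dots> \<le> e" using e nn by (simp add: d_def field_simps)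
    finally show "\<bar>J (I K) - H K\<bar> \<le> 0 + e" by simp
  qed
  then have JH: "J (I K) = H K" by simp
  have HI: "H K = (LINT x|\<mu>. J (F x))"
    unfolding H_def
  proof (intro Bochner_Integration.integral_cong refl)
    fix x assume x: "x \<in> space \<mu>"
    show "indicator K x * J (F x) = J (F x)"
    proof (cases "x \<in> K")
      case False
      have "J (F x) = J (\<lambda>y. 0 * F x y)"
        using x False supp FCc compactly_supported_scale[OF Y.T2 FCc, of x 0]
        by (intro Y.functional_cong) (auto simp: X.space_eq)
      then show ?thesis using Y.functional_scale[OF FCc, of x 0] x by (simp add: X.space_eq)
    qed simp
  qed
  have IK: "I K y = (LINT x|\<mu>. F x y)" if "y \<in> topspace Y" for y
    unfolding I_def
    by (intro Bochner_Integration.integral_cong refl) (use supp that in \<open>auto simp: indicator_def X.space_eq\<close>)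
  have "J (I K) = J (\<lambda>y. LINT x|\<mu>. F x y)"
  proof (rule Y.functional_cong[OF ICc[OF Ksets]])
    show "(\<lambda>y. LINT x|\<mu>. F x y) \<in> compactly_supported Y"
    proof (rule compactly_supportedI[OF Y.T2 _ L])
      show "continuous_map Y euclideanreal (\<lambda>y. LINT x|\<mu>. F x y)"
        by (rule continuous_map_eq[OF compactly_supported_continuous[OF ICc[OF Ksets]]]) (rule IK)
      show "(LINT x|\<mu>. F x y) = 0" if "y \<in> topspace Y" "y \<notin> L" for y
      proof -
        have "(LINT x|\<mu>. F x y) = (LINT x|\<mu>. 0)"
          by (intro Bochner_Integration.integral_cong refl) (use that supp in \<open>auto simp: X.space_eq\<close>)
        then show ?thesis by simp
      qed
    qed
  qed (rule IK)
  then show ?thesis using JH HI by (rule trans[OF sym trans])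
qed

section \<open>Uniqueness of Haar measure\<close>

definition left_invariant_functional ::
    "('a, 'b) monoid_scheme \<Rightarrow> 'a topology \<Rightarrow> (('a \<Rightarrow> real) \<Rightarrow> real) \<Rightarrow> bool" where
  "left_invariant_functional G T J \<longleftrightarrow>
     (\<forall>f\<in>compactly_supported T. \<forall>x\<in>carrier G. J (\<lambda>y. f (x \<otimes>\<^bsub>G\<^esub> y)) = J f)"

lemma compactly_supported_homeomorphic:
  assumes T: "Hausdorff_space T" and f: "f \<in> compactly_supported T"
    and g: "continuous_map S T g" and h: "continuous_map T S h" and S: "Hausdorff_space S"
    and hg: "\<And>x. x \<in> topspace S \<Longrightarrow> h (g x) = x"
  shows "(\<lambda>x. f (g x)) \<in> compactly_supported S"
proof -
  obtain K where K: "continuous_map T euclideanreal f" "compactin T K"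
    "\<And>x. x \<in> topspace T \<Longrightarrow> x \<notin> K \<Longrightarrow> f x = 0" using f by (rule compactly_supportedE) blast
  show ?thesis
  proof (rule compactly_supportedI[OF S])
    show "continuous_map S euclideanreal (\<lambda>x. f (g x))"
      using continuous_map_compose[OF g K(1)] by (simp add: o_def)
    show "compactin S (h ` K)" by (rule image_compactin[OF K(2) h])
    show "f (g x) = 0" if "x \<in> topspace S" "x \<notin> h ` K" for x
    proof -
      have "g x \<in> topspace T" using g that(1) continuous_map_image_subset_topspace by fastforce
      moreover have "g x \<notin> K" using that hg by force
      ultimately show ?thesis by (rule K(3))
    qed
  qed
qed

context locally_compact_group
begin

lemma compactly_supported_left_translate:
  assumes "f \<in> compactly_supported T" "x \<in> carrier G"
  shows "(\<lambda>y. f (x \<otimes> y)) \<in> compactly_supported T"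
proof (rule compactly_supported_homeomorphic[OF Hausdorff assms(1) _ _ Hausdorff, of _ "\<lambda>y. inv x \<otimes> y"])
  show "inv x \<otimes> (x \<otimes> y) = y" if "y \<in> topspace T" for y
    using that assms(2) by (simp add: topspace_eq m_assoc[symmetric])
qed (use assms in \<open>auto intro!: continuous_group_intros\<close>)

lemma compactly_supported_right_translate:
  assumes "f \<in> compactly_supported T" "x \<in> carrier G"
  shows "(\<lambda>y. f (y \<otimes> x)) \<in> compactly_supported T"
proof (rule compactly_supported_homeomorphic[OF Hausdorff assms(1) _ _ Hausdorff, of _ "\<lambda>y. y \<otimes> inv x"])
  show "y \<otimes> x \<otimes> inv x = y" if "y \<in> topspace T" for y
    using that assms(2) by (simp add: topspace_eq m_assoc)
qed (use assms in \<open>auto intro!: continuous_group_intros\<close>)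

lemma continuous_map_right_translates:
  assumes J: "positive_functional T J" and f: "f \<in> compactly_supported T"
  shows "continuous_map T euclideanreal (\<lambda>s. J (\<lambda>t. f (t \<otimes> s)))"
proof -
  interpret positive_functional_on T J
    by (simp add: J Hausdorff locally_compact positive_functional_on_def)
  obtain K where K: "continuous_map T euclideanreal f" "compactin T K"
    "\<And>x. x \<in> topspace T \<Longrightarrow> x \<notin> K \<Longrightarrow> f x = 0" using f by (rule compactly_supportedE) blast
  show ?thesis
  proof (rule continuous_map_functional)
    have "continuous_map (prod_topology T T) T (\<lambda>p. snd p \<otimes> fst p)"
      by (intro continuous_group_intros continuous_map_fst continuous_map_snd)
    from continuous_map_compose[OF this K(1)]
    show "continuous_map (prod_topology T T) euclideanreal (\<lambda>(s, t). f (t \<otimes> s))"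
      by (simp add: o_def case_prod_unfold)
    fix s assume "s \<in> topspace T"
    then obtain U L where UL: "openin T U" "compactin T L" "s \<in> U" "U \<subseteq> L"
      using locally_compact unfolding locally_compact_space_def by metis
    \<comment> \<open>While \<open>s'\<close> stays in the compact set \<open>L\<close>, the
      translated supports all lie in the product of \<open>K\<close> with the inverses of
      \<open>L\<close>, a compact set not depending on \<open>s'\<close>.\<close>
    have "f (t \<otimes> s') = 0" if st: "s' \<in> U" "t \<in> topspace T - (K <#> (\<lambda>x. inv x) ` L)" for s' t
    proof (rule K(3))
      have c: "s' \<in> carrier G" "t \<in> carrier G"
        using st openin_subset_carrier[OF UL(1)] by (auto simp: topspace_eq)
      then show "t \<otimes> s' \<in> topspace T" by (simp add: topspace_eq)
      show "t \<otimes> s' \<notin> K"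
      proof
        assume "t \<otimes> s' \<in> K"
        moreover have "inv s' \<in> (\<lambda>x. inv x) ` L" using st(1) UL(4) by blast
        moreover have "t = t \<otimes> s' \<otimes> inv s'" using c by (simp add: m_assoc)
        ultimately have "t \<in> K <#> (\<lambda>x. inv x) ` L" unfolding set_mult_def by blast
        then show False using st by blast
      qed
    qed
    then show "\<exists>U L. openin T U \<and> s \<in> U \<and> compactin T L \<and>
        (\<forall>s'\<in>U. \<forall>t\<in>topspace T - L. f (t \<otimes> s') = 0)"
      using UL compactin_set_mult[OF K(2) compactin_inv_image[OF UL(2)]] by blast
  qed
qed

end

section \<open>Positivity and invariance of the Haar integral\<close>

locale haar = locally_compact_group +
  fixes \<mu> :: "'a measure"
  assumes lh: "left_haar_measure G T \<mu>"
begin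

sublocale radon T \<mu>
  using lh by unfold_locales (auto simp: left_haar_measure_def Hausdorff locally_compact)

sublocale integral: positive_functional_on T "\<lambda>f. LINT x|\<mu>. f x"
  by (rule positive_functional_integral)

lemma space_eq_carrier: "space \<mu> = carrier G"
  by (simp add: space_eq topspace_eq)

lemma emeasure_l_coset: "x \<in> carrier G \<Longrightarrow> A \<in> sets \<mu> \<Longrightarrow> emeasure \<mu> (x <# A) = emeasure \<mu> A"
  using lh by (simp add: left_haar_measure_def)

text \<open>Finitely many translates of an open neighbourhood of the identity cover a compact set. A
  null open set would thus make all compact sets null and, by inner regularity, the whole
  space.\<close>

lemma emeasure_open_pos:
  assumes U: "openin T U" "u \<in> U"
  shows "emeasure \<mu> U \<noteq> 0"
proof
  assume 0: "emeasure \<mu> U = 0"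
  have u: "u \<in> carrier G" using U openin_subset_carrier by blast
  define V where "V = inv u <# U"
  have V: "openin T V" "\<one> \<in> V"
  proof -
    show "openin T V" unfolding V_def using u U by (intro openin_l_coset) auto
    have "inv u \<otimes> u \<in> V" unfolding V_def l_coset_image using U by blast
    then show "\<one> \<in> V" using u by simp
  qed
  have V0: "emeasure \<mu> V = 0"
    using 0 emeasure_l_coset[of "inv u" U] u sets_openin[OF U(1)] by (simp add: V_def)
  have K0: "emeasure \<mu> K = 0" if K: "compactin T K" for K
  proof -
    obtain S where S: "finite S" "S \<subseteq> carrier G" "K \<subseteq> (\<Union>s\<in>S. s <# V)"
      using covering_numberE[OF K V] by metis
    have sV: "s <# V \<in> sets \<mu>" "emeasure \<mu> (s <# V) = 0" if "s \<in> S" for s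
      using S that V V0 emeasure_l_coset sets_openin openin_l_coset by auto
    have "(\<Union>s\<in>S. s <# V) \<in> null_sets \<mu>"
      using S(1) sV by (intro null_sets_UN') (auto intro: countable_finite)
    then show ?thesis using S(3) sets_compactin[OF K] null_sets_subset by blast
  qed
  have op: "openin T (topspace T)" by simp
  have "emeasure \<mu> (topspace T) = (SUP K\<in>{K. compactin T K \<and> K \<subseteq> topspace T}. emeasure \<mu> K)"
    using rm op unfolding radon_measure_def by blast
  also have "\<dots> \<le> 0" by (rule SUP_least) (use K0 in auto)
  finally show False using lh by (simp add: left_haar_measure_def space_eq)
qed

lemma integral_pos:
  assumes f: "f \<in> compactly_supported T" and nn: "\<And>x. x \<in> carrier G \<Longrightarrow> 0 \<le> f x"
    and a: "a \<in> carrier G" "0 < f a"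
  shows "0 < (LINT x|\<mu>. f x)"
proof -
  have "(LINT x|\<mu>. f x) \<noteq> 0"
  proof
    assume "(LINT x|\<mu>. f x) = 0"
    moreover have "AE x in \<mu>. 0 \<le> f x"
      using nn by (intro AE_I2) (simp add: space_eq_carrier)
    ultimately have "AE x in \<mu>. f x = 0"
      using integral_nonneg_eq_0_iff_AE[OF integrable_compactly_supported[OF f]] by simp
    moreover have op: "openin T {x \<in> topspace T. f x \<in> {0<..}}"
      using compactly_supported_continuous[OF f] by (rule openin_continuous_map_preimage) simp
    ultimately have "emeasure \<mu> {x \<in> topspace T. f x \<in> {0<..}} = 0"
      unfolding space_eq[symmetric] by (intro emeasure_eq_0_AE) (auto elim!: eventually_mono)
    then show False using emeasure_open_pos[OF op, of a] a by (simp add: topspace_eq)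
  qed
  moreover have "0 \<le> (LINT x|\<mu>. f x)"
    using nn by (intro Bochner_Integration.integral_nonneg) (simp add: space_eq_carrier)
  ultimately show ?thesis by simp
qed

lemma compactly_supported_integral_pos:
  assumes "a \<in> carrier G"
  obtains f where "f \<in> compactly_supported T" "\<And>x. x \<in> carrier G \<Longrightarrow> 0 \<le> f x" "f a = 1"
    "0 < (LINT x|\<mu>. f x)"
proof -
  obtain f where f: "f \<in> compactly_supported T" "\<And>x. x \<in> topspace T \<Longrightarrow> 0 \<le> f x" "\<And>x. x \<in> {a} \<Longrightarrow> f x = 1"
    using compactly_supported_cutoff[OF Hausdorff locally_compact, of "{a}"] assms
    by (auto simp: topspace_eq)
  then show thesis using that[of f] integral_pos[OF f(1), of a] assms by (simp add: topspace_eq)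
qed

text \<open>Invariance on Borel sets says that the image of \<mu> under left multiplication is \<mu>
  itself.\<close>

lemma integral_left_invariant:
  assumes f: "f \<in> compactly_supported T" and x: "x \<in> carrier G"
  shows "(LINT y|\<mu>. f (x \<otimes> y)) = (LINT y|\<mu>. f y)"
proof -
  have m: "(\<lambda>y. x \<otimes> y) \<in> measurable \<mu> \<mu>"
    by (rule measurable_continuous_map[where T = T and T' = T])
      (use x in \<open>auto intro!: continuous_group_intros simp: space_eq sets_eq\<close>)
  have "distr \<mu> \<mu> (\<lambda>y. x \<otimes> y) = \<mu>"
  proof (rule measure_eqI)
    fix A assume "A \<in> sets (distr \<mu> \<mu> (\<lambda>y. x \<otimes> y))"
    then have A: "A \<in> sets \<mu>" by simp
    have "A \<subseteq> carrier G" using sets.sets_into_space[OF A] by (simp add: space_eq_carrier)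
    then have "(\<lambda>y. x \<otimes> y) -` A \<inter> space \<mu> = inv x <# A"
      using l_coset_vimage[of "inv x" A] x by (auto simp: space_eq_carrier)
    then show "emeasure (distr \<mu> \<mu> (\<lambda>y. x \<otimes> y)) A = emeasure \<mu> A"
      using emeasure_distr[OF m A] emeasure_l_coset[OF _ A] x by simp
  qed simp
  then have "(LINT y|\<mu>. f y) = (LINT y|distr \<mu> \<mu> (\<lambda>y. x \<otimes> y). f y)" by simp
  also have "\<dots> = (LINT y|\<mu>. f (x \<otimes> y))"
    by (rule integral_distr[OF m]) (use f borel_measurable_continuous compactly_supported_continuous in auto)
  finally show ?thesis by simp
qed

lemma left_invariant_integral: "left_invariant_functional G T (\<lambda>f. LINT x|\<mu>. f x)"
  using integral_left_invariant by (simp add: left_invariant_functional_def)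

text \<open>Four moves: left invariance of \<open>J\<close> replaces g(t) by g(s^-1 t), the two
  integrations are exchanged, left invariance of \<mu> substitutes ts for s, and the integrations
  are exchanged back. The first function is then translated under \<open>J\<close> while the second
  stands outside it.\<close>

lemma integral_mult_functional:
  assumes J: "positive_functional T J" "left_invariant_functional G T J"
    and f: "f \<in> compactly_supported T" and g: "g \<in> compactly_supported T"
  shows "(LINT x|\<mu>. f x) * J g = (LINT s|\<mu>. J (\<lambda>t. f (t \<otimes> s)) * g (inv s))"
proof -
  interpret J: positive_functional_on T J
    by (simp add: J Hausdorff locally_compact positive_functional_on_def)
  obtain K where K: "continuous_map T euclideanreal f" "compactin T K"
    "\<And>x. x \<in> topspace T \<Longrightarrow> x \<notin> K \<Longrightarrow> f x = 0" using f by (rule compactly_supportedE) blast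
  obtain L where L: "continuous_map T euclideanreal g" "compactin T L"
    "\<And>x. x \<in> topspace T \<Longrightarrow> x \<notin> L \<Longrightarrow> g x = 0" using g by (rule compactly_supportedE) blast
  let ?T2 = "prod_topology T T"
  have cont: "continuous_map ?T2 euclideanreal (\<lambda>p. f (u p) * g (v p))"
    if "continuous_map ?T2 T u" "continuous_map ?T2 T v" for u v
    using continuous_map_compose[OF that(1) K(1)] continuous_map_compose[OF that(2) L(1)]
    by (intro continuous_map_real_mult) (auto simp: o_def)
  have KL: "compactin T (K <#> L)" by (rule compactin_set_mult[OF K(2) L(2)])
  have Linv: "compactin T ((\<lambda>x. inv x) ` L)" by (rule compactin_inv_image[OF L(2)])
  have in_KL: "k \<otimes> l \<in> K <#> L" if "k \<in> K" "l \<in> L" for k l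
    using that by (auto simp: set_mult_def)
  have supp1: "f s * g (inv s \<otimes> t) = 0"
    if "s \<in> topspace T" "t \<in> topspace T" "s \<notin> K \<or> t \<notin> K <#> L" for s t
  proof (rule ccontr)
    assume nz: "f s * g (inv s \<otimes> t) \<noteq> 0"
    have c: "s \<in> carrier G" "t \<in> carrier G" using that by (auto simp: topspace_eq)
    have "s \<in> K" using nz K(3) that by fastforce
    moreover have "inv s \<otimes> t \<in> L" using nz L(3)[of "inv s \<otimes> t"] c by (auto simp: topspace_eq)
    moreover have "s \<otimes> (inv s \<otimes> t) = t" using c by (simp add: m_assoc[symmetric])
    ultimately show False using that(3) in_KL[of s "inv s \<otimes> t"] by simp
  qed
  have supp2: "f (t \<otimes> s) * g (inv s) = 0"
    if "s \<in> topspace T" "t \<in> topspace T" "s \<notin> (\<lambda>x. inv x) ` L \<or> t \<notin> K <#> L" for s t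
  proof (rule ccontr)
    assume nz: "f (t \<otimes> s) * g (inv s) \<noteq> 0"
    have c: "s \<in> carrier G" "t \<in> carrier G" using that by (auto simp: topspace_eq)
    have 1: "t \<otimes> s \<in> K" using nz K(3)[of "t \<otimes> s"] c by (auto simp: topspace_eq)
    have 2: "inv s \<in> L" using nz L(3)[of "inv s"] c by (auto simp: topspace_eq)
    then have "inv (inv s) \<in> (\<lambda>x. inv x) ` L" by blast
    moreover have "t \<otimes> s \<otimes> inv s = t" using c by (simp add: m_assoc)
    ultimately show False using that(3) in_KL[OF 1 2] c by simp
  qed
  have gCc: "(\<lambda>t. g (inv s \<otimes> t)) \<in> compactly_supported T" if "s \<in> carrier G" for s
    using compactly_supported_left_translate[OF g] that by simp
  have cont1: "continuous_map ?T2 euclideanreal (\<lambda>(s, t). f s * g (inv s \<otimes> t))"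
    unfolding case_prod_unfold
    by (intro cont continuous_group_intros continuous_map_fst continuous_map_snd)
  have cont2: "continuous_map ?T2 euclideanreal (\<lambda>(s, t). f (t \<otimes> s) * g (inv s))"
    unfolding case_prod_unfold
    by (intro cont continuous_group_intros continuous_map_fst continuous_map_snd)
  have "(LINT x|\<mu>. f x) * J g = (LINT s|\<mu>. f s * J g)" by simp
  also have "\<dots> = (LINT s|\<mu>. J (\<lambda>t. f s * g (inv s \<otimes> t)))"
  proof (rule Bochner_Integration.integral_cong[OF refl])
    fix s assume "s \<in> space \<mu>"
    then have s: "s \<in> carrier G" by (simp add: space_eq_carrier)
    have "J g = J (\<lambda>t. g (inv s \<otimes> t))"
      using J(2) g s by (simp add: left_invariant_functional_def)
    then show "f s * J g = J (\<lambda>t. f s * g (inv s \<otimes> t))"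
      using J.functional_scale[OF gCc[OF s]] by simp
  qed
  also have "\<dots> = J (\<lambda>t. LINT s|\<mu>. f s * g (inv s \<otimes> t))"
    by (rule functional_integral_commute[OF radon_axioms J.positive_functional_on_axioms cont1 K(2) KL supp1,
          symmetric])
  also have "\<dots> = J (\<lambda>t. LINT s|\<mu>. f (t \<otimes> s) * g (inv s))"
  proof (rule J.functional_cong)
    \<comment> \<open>\<open>J\<close> may be applied to pointwise equal functions only after both
      are known to be continuous with compact support.\<close>
    have cs: "(\<lambda>t. LINT s|\<mu>. F s t) \<in> compactly_supported T"
      if F: "continuous_map ?T2 euclideanreal (\<lambda>(s, t). F s t)" and C: "compactin T C"
        and s: "\<And>s t. s \<in> topspace T \<Longrightarrow> t \<in> topspace T \<Longrightarrow> s \<notin> C \<or> t \<notin> K <#> L \<Longrightarrow> F s t = 0"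
      for F C
    proof (rule compactly_supportedI[OF Hausdorff _ KL])
      have F_swap: "continuous_map ?T2 euclideanreal (\<lambda>(t, s). F s t)"
        using continuous_map_compose[OF continuous_map_pairedI[OF continuous_map_snd continuous_map_fst] F]
        by (simp add: case_prod_unfold o_def)
      show "continuous_map T euclideanreal (\<lambda>t. LINT s|\<mu>. F s t)"
      proof (rule integral.continuous_map_functional[OF F_swap])
        fix t assume "t \<in> topspace T"
        then show "\<exists>U L. openin T U \<and> t \<in> U \<and> compactin T L \<and> (\<forall>t'\<in>U. \<forall>s\<in>topspace T - L. F s t' = 0)"
          using C s by (intro exI[of _ "topspace T"] exI[of _ C]) auto
      qed
      fix t assume "t \<in> topspace T" "t \<notin> K <#> L"
      then have "(LINT s|\<mu>. F s t) = (LINT s|\<mu>. 0)"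
        by (intro Bochner_Integration.integral_cong) (auto simp: s space_eq)
      then show "(LINT s|\<mu>. F s t) = 0" by simp
    qed
    show "(\<lambda>t. LINT s|\<mu>. f s * g (inv s \<otimes> t)) \<in> compactly_supported T"
      by (rule cs[OF cont1 K(2) supp1])
    show "(\<lambda>t. LINT s|\<mu>. f (t \<otimes> s) * g (inv s)) \<in> compactly_supported T"
      by (rule cs[OF cont2 Linv supp2])
    fix t assume "t \<in> topspace T"
    then have t: "t \<in> carrier G" by (simp add: topspace_eq)
    have "continuous_map T euclideanreal (\<lambda>s. f s * g (inv s \<otimes> t))"
    proof -
      have "continuous_map T T (\<lambda>s. inv s \<otimes> t)"
        using t by (intro continuous_group_intros)
      from continuous_map_compose[OF this L(1)] show ?thesis
        using K(1) by (intro continuous_map_real_mult) (auto simp: o_def)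
    qed
    then have "(\<lambda>s. f s * g (inv s \<otimes> t)) \<in> compactly_supported T"
      by (rule compactly_supportedI[OF Hausdorff _ K(2)]) (use K(3) in simp)
    from integral_left_invariant[OF this t]
    have "(LINT s|\<mu>. f s * g (inv s \<otimes> t)) = (LINT s|\<mu>. f (t \<otimes> s) * g (inv (t \<otimes> s) \<otimes> t))" by simp
    also have "\<dots> = (LINT s|\<mu>. f (t \<otimes> s) * g (inv s))"
    proof (rule Bochner_Integration.integral_cong[OF refl])
      fix s assume "s \<in> space \<mu>"
      then have s: "s \<in> carrier G" by (simp add: space_eq_carrier)
      have "inv (t \<otimes> s) \<otimes> t = inv s" using s t by (simp add: inv_mult_group m_assoc)
      then show "f (t \<otimes> s) * g (inv (t \<otimes> s) \<otimes> t) = f (t \<otimes> s) * g (inv s)" by simp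
    qed
    finally show "(LINT s|\<mu>. f s * g (inv s \<otimes> t)) = (LINT s|\<mu>. f (t \<otimes> s) * g (inv s))" .
  qed
  also have "\<dots> = (LINT s|\<mu>. J (\<lambda>t. f (t \<otimes> s) * g (inv s)))"
    by (rule functional_integral_commute[OF radon_axioms J.positive_functional_on_axioms cont2 Linv KL supp2])
  also have "\<dots> = (LINT s|\<mu>. J (\<lambda>t. f (t \<otimes> s)) * g (inv s))"
  proof (rule Bochner_Integration.integral_cong[OF refl])
    fix s assume "s \<in> space \<mu>"
    then have s: "s \<in> carrier G" by (simp add: space_eq_carrier)
    show "J (\<lambda>t. f (t \<otimes> s) * g (inv s)) = J (\<lambda>t. f (t \<otimes> s)) * g (inv s)"
      using J.functional_scale[OF compactly_supported_right_translate[OF f s], of "g (inv s)"]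
      by (simp add: mult.commute)
  qed
  finally show ?thesis .
qed

text \<open>By the previous lemma, \<open>J\<close> is determined by the continuous function
  \<open>s \<mapsto> J (\<lambda>t. f (t \<otimes> s)) / (LINT x|\<mu>. f x)\<close>, which therefore does not depend on \<open>f\<close>;
  comparing its values at \<open>\<one>\<close> gives the claim.\<close>

lemma functional_cross_ratio:
  assumes J: "positive_functional T J" "left_invariant_functional G T J"
    and f: "f \<in> compactly_supported T" and g: "g \<in> compactly_supported T"
  shows "(LINT x|\<mu>. f x) * J g = (LINT x|\<mu>. g x) * J f"
proof -
  interpret J: positive_functional_on T J
    by (simp add: J Hausdorff locally_compact positive_functional_on_def)
  let ?I = "\<lambda>f. LINT x|\<mu>. f x"
  \<comment> \<open>The difference of the two quotients attached to \<open>f\<close> and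
    \<open>g\<close>, with denominators cleared; the aim is that it vanishes at the
    identity.\<close>
  define D where "D s = ?I g * J (\<lambda>t. f (t \<otimes> s)) - ?I f * J (\<lambda>t. g (t \<otimes> s))" for s
  have D_cont: "continuous_map T euclideanreal D"
    unfolding D_def[abs_def]
    by (intro continuous_map_diff continuous_map_real_mult_left continuous_map_right_translates[OF J(1)] f g)
  \<comment> \<open>By \<open>integral_mult_functional\<close>, both terms equal the product of the
    integrals of \<open>f\<close> and \<open>g\<close> with \<open>J k\<close>.\<close>
  have orth: "(LINT s|\<mu>. D s * k (inv s)) = 0" if k: "k \<in> compactly_supported T" for k
  proof -
    have kinv: "(\<lambda>s. k (inv s)) \<in> compactly_supported T"
      by (rule compactly_supported_homeomorphic[OF Hausdorff k continuous_inv continuous_inv Hausdorff])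
        (simp add: topspace_eq)
    have int: "integrable \<mu> (\<lambda>s. J (\<lambda>t. h (t \<otimes> s)) * k (inv s))" if "h \<in> compactly_supported T" for h
      by (intro integrable_compactly_supported compactly_supported_mult_right[OF Hausdorff kinv]
          continuous_map_right_translates J that)
    have "(LINT s|\<mu>. D s * k (inv s)) = (LINT s|\<mu>. ?I g * (J (\<lambda>t. f (t \<otimes> s)) * k (inv s))
        - ?I f * (J (\<lambda>t. g (t \<otimes> s)) * k (inv s)))"
      by (simp add: D_def algebra_simps)
    also have "\<dots> = ?I g * (LINT s|\<mu>. J (\<lambda>t. f (t \<otimes> s)) * k (inv s))
        - ?I f * (LINT s|\<mu>. J (\<lambda>t. g (t \<otimes> s)) * k (inv s))"
      using int[OF f] int[OF g] by simp
    also have "\<dots> = 0"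
      unfolding integral_mult_functional[OF J f k, symmetric] integral_mult_functional[OF J g k, symmetric]
      by simp
    finally show ?thesis .
  qed
  obtain \<psi> where \<psi>: "\<psi> \<in> compactly_supported T" "\<And>x. x \<in> carrier G \<Longrightarrow> 0 \<le> \<psi> x" "\<psi> \<one> = 1"
    using compactly_supported_integral_pos[OF one_closed] by metis
  \<comment> \<open>This test function is chosen so that orthogonality becomes vanishing of the
    integral of D^2 \<psi>, a nonnegative function that would be positive at the identity if
    \<open>D\<close> were nonzero there.\<close>
  have k: "(\<lambda>s. D (inv s) * \<psi> (inv s)) \<in> compactly_supported T"
    by (rule compactly_supported_homeomorphic[OF Hausdorff
          compactly_supported_mult_right[OF Hausdorff \<psi>(1) D_cont] continuous_inv continuous_inv Hausdorff])
      (simp add: topspace_eq)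
  have "(LINT s|\<mu>. D s * (D s * \<psi> s)) = (LINT s|\<mu>. D s * (D (inv (inv s)) * \<psi> (inv (inv s))))"
    by (rule Bochner_Integration.integral_cong) (auto simp: space_eq_carrier)
  also have "\<dots> = 0" by (rule orth[OF k])
  finally have "(LINT s|\<mu>. D s * (D s * \<psi> s)) = 0" .
  moreover have "(\<lambda>s. D s * (D s * \<psi> s)) \<in> compactly_supported T"
    by (intro compactly_supported_mult_right Hausdorff \<psi> D_cont)
  moreover have "0 \<le> D s * (D s * \<psi> s)" if "s \<in> carrier G" for s
    using \<psi>(2)[OF that] by (simp add: mult.assoc[symmetric])
  ultimately have "\<not> 0 < D \<one> * (D \<one> * \<psi> \<one>)"
    using integral_pos[of "\<lambda>s. D s * (D s * \<psi> s)" \<one>] by force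
  then have "D \<one> = 0" using \<psi>(3) by (auto simp: zero_less_mult_iff not_less)
  moreover have "J (\<lambda>t. h (t \<otimes> \<one>)) = J h" if "h \<in> compactly_supported T" for h
    by (rule J.functional_cong) (use that compactly_supported_right_translate in \<open>auto simp: topspace_eq\<close>)
  ultimately show ?thesis using f g by (simp add: D_def)
qed

text \<open>The constant is read off from any \<open>g\<close> of positive integral by the cross
  ratio.\<close>

lemma left_invariant_functional_unique:
  assumes J: "positive_functional T J" "left_invariant_functional G T J"
  obtains c where "0 \<le> c" "\<And>f. f \<in> compactly_supported T \<Longrightarrow> J f = c * (LINT x|\<mu>. f x)"
proof -
  obtain g where g: "g \<in> compactly_supported T" "\<And>x. x \<in> carrier G \<Longrightarrow> 0 \<le> g x" "0 < (LINT x|\<mu>. g x)"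
    using compactly_supported_integral_pos[OF one_closed] by metis
  have "0 \<le> J g" using J(1) g by (simp add: positive_functional_def topspace_eq)
  then show thesis
    using that[of "J g / (LINT x|\<mu>. g x)"] functional_cross_ratio[OF J g(1)] g(3)
    by (simp add: field_simps)
qed

end

section \<open>The modular function\<close>

lemma positive_functional_compose:
  assumes "positive_functional T J"
    and "\<And>f. f \<in> compactly_supported S \<Longrightarrow> (\<lambda>x. f (g x)) \<in> compactly_supported T"
    and "\<And>x. x \<in> topspace T \<Longrightarrow> g x \<in> topspace S"
  shows "positive_functional S (\<lambda>f. J (\<lambda>x. f (g x)))"
  using assms unfolding positive_functional_def by simp

context haar
begin

text \<open>Right translation commutes with left translation, so the translated integral is
  left-invariant and uniqueness applies.\<close>

lemma integral_right_translate:
  assumes x: "x \<in> carrier G"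
  obtains c where "\<And>f. f \<in> compactly_supported T \<Longrightarrow> (LINT l|\<mu>. f (l \<otimes> x)) = c * (LINT l|\<mu>. f l)"
proof (rule left_invariant_functional_unique)
  show "positive_functional T (\<lambda>f. LINT l|\<mu>. f (l \<otimes> x))"
    by (rule positive_functional_compose[OF integral.pf])
      (use x compactly_supported_right_translate in \<open>auto simp: topspace_eq\<close>)
  show "left_invariant_functional G T (\<lambda>f. LINT l|\<mu>. f (l \<otimes> x))"
    unfolding left_invariant_functional_def
  proof (intro ballI)
    fix f y assume f: "f \<in> compactly_supported T" and y: "y \<in> carrier G"
    have "(LINT l|\<mu>. f (y \<otimes> (l \<otimes> x))) = (LINT l|\<mu>. f (y \<otimes> l \<otimes> x))"
      using x y by (intro Bochner_Integration.integral_cong) (auto simp: m_assoc space_eq_carrier)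
    also have "\<dots> = (LINT l|\<mu>. f (l \<otimes> x))"
      by (rule integral_left_invariant[OF compactly_supported_right_translate[OF f x] y])
    finally show "(LINT l|\<mu>. f (y \<otimes> (l \<otimes> x))) = (LINT l|\<mu>. f (l \<otimes> x))" .
  qed
qed (use that in blast)

lemma is_modular_function_ex1: "\<exists>!\<Delta>. is_modular_function G T \<Delta>"
proof -
  let ?I = "\<lambda>f. LINT l|\<mu>. f l" and ?R = "\<lambda>x f. LINT l|\<mu>. f (l \<otimes> x)"
  obtain g where g: "g \<in> compactly_supported T" "0 < ?I g"
    using compactly_supported_integral_pos[OF one_closed] by metis
  \<comment> \<open>The factor by which right translation scales the integral, measured on one fixed
    \<open>g\<close>; it is the inverse of the modular function.\<close>
  define c where "c x = ?R x g / ?I g" for x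
  have c: "?R x f = c x * ?I f" if x: "x \<in> carrier G" and f: "f \<in> compactly_supported T" for x f
  proof -
    obtain c' where "\<And>f. f \<in> compactly_supported T \<Longrightarrow> ?R x f = c' * ?I f"
      using integral_right_translate[OF x] by metis
    then show ?thesis using g f by (simp add: c_def)
  qed
  have c_mult: "c (x \<otimes> y) = c x * c y" if "x \<in> carrier G" "y \<in> carrier G" for x y
  proof -
    have "?R (x \<otimes> y) g = ?R x (\<lambda>l. g (l \<otimes> y))"
      using that by (intro Bochner_Integration.integral_cong) (auto simp: m_assoc space_eq_carrier)
    also have "\<dots> = c x * (c y * ?I g)"
      using c[OF that(1) compactly_supported_right_translate[OF g(1) that(2)]] c[OF that(2) g(1)] by simp
    finally show ?thesis using g(2) by (simp add: c_def)
  qed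
  have c_one: "c \<one> = 1"
  proof -
    have "?R \<one> g = ?I g"
      by (intro Bochner_Integration.integral_cong) (auto simp: space_eq_carrier)
    then show ?thesis using g(2) by (simp add: c_def)
  qed
  have c_pos: "0 < c x" if x: "x \<in> carrier G" for x
  proof -
    obtain k where k: "k \<in> compactly_supported T" "\<And>y. y \<in> carrier G \<Longrightarrow> 0 \<le> k y" "0 < ?I k"
      using compactly_supported_integral_pos[OF one_closed] by metis
    have "0 \<le> c x * ?I k"
      unfolding c[OF x k(1), symmetric]
      using x k(2) by (intro Bochner_Integration.integral_nonneg) (simp add: space_eq_carrier)
    \<comment> \<open>Positivity of the integral gives only \<open>0 \<le> c x\<close>;
      invertibility excludes 0.\<close>
    moreover have "c x * c (inv x) = 1" using c_mult[of x "inv x"] c_one x by simp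
    ultimately show ?thesis using k(3) by (auto simp: zero_le_mult_iff order_less_le)
  qed
  have c_cont: "continuous_map T euclideanreal c"
    unfolding c_def[abs_def]
    by (rule continuous_map_real_divide)
      (use g continuous_map_right_translates[OF integral.pf g(1)] in auto)
  define \<Delta> where "\<Delta> = restrict (\<lambda>x. inverse (c x)) (carrier G)"
  have "is_modular_function G T \<Delta>"
    unfolding is_modular_function_def
  proof (intro conjI allI impI ballI)
    show "\<Delta> \<in> extensional (carrier G)" by (simp add: \<Delta>_def)
    have "continuous_map T euclideanreal (\<lambda>x. inverse (c x))"
      by (rule continuous_map_real_inverse[OF c_cont]) (use c_pos in \<open>force simp: topspace_eq\<close>)
    then have "continuous_map T euclideanreal \<Delta>"
      by (rule continuous_map_eq) (simp add: \<Delta>_def topspace_eq)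
    then show "continuous_map T (top_of_set {0<..}) \<Delta>"
      using c_pos by (auto simp: continuous_map_in_subtopology \<Delta>_def topspace_eq)
    show "\<Delta> (x \<otimes> y) = \<Delta> x * \<Delta> y" if "x \<in> carrier G" "y \<in> carrier G" for x y
      using that c_mult by (simp add: \<Delta>_def)
    fix \<nu> f x assume \<nu>: "left_haar_measure G T \<nu>" and f: "f \<in> compactly_supported T" and x: "x \<in> carrier G"
    interpret \<nu>: haar G T \<nu> by unfold_locales (rule \<nu>)
    \<comment> \<open>Any other Haar measure has integrals proportional to those of \<mu>, so the
      same factor serves for it.\<close>
    obtain a where a: "\<And>f. f \<in> compactly_supported T \<Longrightarrow> (LINT l|\<nu>. f l) = a * ?I f"
      using left_invariant_functional_unique[OF \<nu>.integral.pf \<nu>.left_invariant_integral] by metis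
    show "(LINT l|\<nu>. f (l \<otimes> x)) = inverse (\<Delta> x) * (LINT l|\<nu>. f l)"
      using a[OF f] a[OF compactly_supported_right_translate[OF f x]] c[OF x f] x by (simp add: \<Delta>_def)
  qed
  moreover have "\<Delta>1 = \<Delta>2" if "is_modular_function G T \<Delta>1" "is_modular_function G T \<Delta>2" for \<Delta>1 \<Delta>2
  proof (rule extensionalityI)
    show "\<Delta>1 \<in> extensional (carrier G)" "\<Delta>2 \<in> extensional (carrier G)"
      using that by (auto simp: is_modular_function_def)
    fix x assume x: "x \<in> carrier G"
    have "inverse (\<Delta>1 x) * ?I g = inverse (\<Delta>2 x) * ?I g"
      using that g(1) x lh unfolding is_modular_function_def by metis
    then show "\<Delta>1 x = \<Delta>2 x" using g(2) by simp
  qed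
  ultimately show ?thesis by blast
qed

end

context locally_compact_group
begin

lemma haar_exists: obtains \<mu> where "haar G T \<mu>"
  using left_haar_measure_exists locally_compact_group_axioms
  by (metis haar.intro haar_axioms.intro)

lemma is_modular_function_modular_function: "is_modular_function G T (modular_function G T)"
proof -
  obtain \<mu> where "haar G T \<mu>" by (rule haar_exists)
  then show ?thesis
    unfolding modular_function_def using haar.is_modular_function_ex1 by (metis theI')
qed

lemma modular_function_pos: "x \<in> carrier G \<Longrightarrow> 0 < modular_function G T x"
  using is_modular_function_modular_function
  by (auto simp: is_modular_function_def continuous_map_in_subtopology topspace_eq)

text \<open>Carries the defining identity of the modular function over to functionals that are not
  given by a measure, as needed for iterated integration over \<open>G Mod N\<close>.\<close>

lemma functional_right_translate:
  assumes J: "positive_functional T J" "left_invariant_functional G T J"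
    and f: "f \<in> compactly_supported T" and x: "x \<in> carrier G"
  shows "J (\<lambda>l. f (l \<otimes> x)) = inverse (modular_function G T x) * J f"
proof -
  obtain \<mu> where "haar G T \<mu>" by (rule haar_exists)
  then interpret haar G T \<mu> .
  obtain c where c: "\<And>f. f \<in> compactly_supported T \<Longrightarrow> J f = c * (LINT x|\<mu>. f x)"
    using left_invariant_functional_unique[OF J] by metis
  have "(LINT l|\<mu>. f (l \<otimes> x)) = inverse (modular_function G T x) * (LINT l|\<mu>. f l)"
    using is_modular_function_modular_function lh f x unfolding is_modular_function_def by blast
  then show ?thesis using c[OF f] c[OF compactly_supported_right_translate[OF f x]] by simp
qed

end

section \<open>Closed subgroups and quotients\<close>

lemma (in locally_compact_group) locally_compact_subgroup:
  assumes H: "subgroup H G" "closedin T H"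
  shows "locally_compact_group (G\<lparr>carrier := H\<rparr>) (subtopology T H)"
proof -
  have HG: "H \<subseteq> carrier G" using H(1) subgroup.subset by blast
  interpret H: group "G\<lparr>carrier := H\<rparr>"
    by (rule subgroup.subgroup_is_group[OF H(1) group_axioms])
  have inv_eq: "inv\<^bsub>G\<lparr>carrier := H\<rparr>\<^esub> x = inv x" if "x \<in> H" for x
    using m_inv_consistent[OF H(1) that] .
  show ?thesis
  proof
    show top: "topspace (subtopology T H) = carrier (G\<lparr>carrier := H\<rparr>)"
      using HG by (auto simp: topspace_eq)
    have sub: "prod_topology (subtopology T H) (subtopology T H) = subtopology (prod_topology T T) (H \<times> H)"
      by (simp add: subtopology_Times)
    show "continuous_map (prod_topology (subtopology T H) (subtopology T H)) (subtopology T H)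
        (\<lambda>(x, y). x \<otimes>\<^bsub>G\<lparr>carrier := H\<rparr>\<^esub> y)"
      unfolding sub continuous_map_in_subtopology
      using continuous_mult subgroup.m_closed[OF H(1)] by (auto intro!: continuous_map_from_subtopology)
    have "continuous_map (subtopology T H) T (\<lambda>x. inv x)"
      by (rule continuous_map_from_subtopology[OF continuous_inv])
    then have "continuous_map (subtopology T H) T (\<lambda>x. inv\<^bsub>G\<lparr>carrier := H\<rparr>\<^esub> x)"
      by (rule continuous_map_eq) (simp add: inv_eq)
    then show "continuous_map (subtopology T H) (subtopology T H) (\<lambda>x. inv\<^bsub>G\<lparr>carrier := H\<rparr>\<^esub> x)"
      unfolding continuous_map_in_subtopology
      using inv_eq subgroup.m_inv_closed[OF H(1)] by auto
    show "locally_compact_space (subtopology T H)"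
      by (rule locally_compact_space_closed_subset[OF locally_compact H(2)])
    show "Hausdorff_space (subtopology T H)" by (rule Hausdorff_space_subtopology[OF Hausdorff])
  qed
qed

section \<open>The quotient by a closed normal subgroup\<close>

locale closed_normal_subgroup = locally_compact_group G T + normal N G
  for G :: "('a, 'b) monoid_scheme" (structure) and T :: "'a topology" and N :: "'a set" +
  assumes closed: "closedin T N"
begin

abbreviation p :: "'a \<Rightarrow> 'a set" where "p \<equiv> coset_map G N"
abbreviation Q :: "'a set topology" where "Q \<equiv> quotient_topology T p"

lemma carrier_Mod: "carrier (G Mod N) = p ` carrier G"
  by (simp add: carrier_FactGroup coset_map_def)

lemma p_mult: "x \<in> carrier G \<Longrightarrow> y \<in> carrier G \<Longrightarrow> p x <#> p y = p (x \<otimes> y)"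
  by (simp add: coset_map_def rcos_sum)

lemma p_inv: "x \<in> carrier G \<Longrightarrow> inv\<^bsub>G Mod N\<^esub> (p x) = p (inv x)"
  by (simp add: carrier_Mod inv_FactGroup coset_map_def rcos_inv)

lemma p_eqD:
  assumes "x \<in> carrier G" "y \<in> carrier G" "p x = p y"
  shows "\<exists>n\<in>N. x = n \<otimes> y" "\<exists>n\<in>N. x = y \<otimes> n"
proof -
  have "x \<in> N #> x" by (rule rcos_self) (use assms subgroup_axioms in auto)
  then have "x \<in> N #> y" using assms(3) by (simp add: coset_map_def)
  then show "\<exists>n\<in>N. x = n \<otimes> y" by (auto simp: r_coset_def)
  have "x \<in> y <# N" using \<open>x \<in> N #> y\<close> coset_eq assms(2) by simp
  then show "\<exists>n\<in>N. x = y \<otimes> n" by (auto simp: l_coset_def)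
qed

lemma p_mult_left: "n \<in> N \<Longrightarrow> x \<in> carrier G \<Longrightarrow> p (n \<otimes> x) = p x"
  using coset_mult_assoc[of N n x] coset_join2[of n N] subset mem_carrier subgroup_axioms
  by (simp add: coset_map_def)

lemma p_mult_right: "n \<in> N \<Longrightarrow> x \<in> carrier G \<Longrightarrow> p (x \<otimes> n) = p x"
  using p_mult_left[of "x \<otimes> n \<otimes> inv x" x] inv_op_closed2[of x n] mem_carrier[of n]
  by (simp add: m_assoc)

lemma quotient_map_p: "quotient_map T Q p"
  by (rule quotient_map_quotient_topology)

lemma continuous_map_p: "continuous_map T Q p"
  using quotient_map_p quotient_imp_continuous_map by blast

text \<open>The preimage of the image of \<open>U\<close> is the union of the open translates
  \<open>n <# U\<close> with \<open>n\<close> in \<open>N\<close>.\<close>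

lemma open_map_p: "open_map T Q p"
  unfolding open_map_def
proof (intro allI impI)
  fix U assume U: "openin T U"
  note Uc = openin_subset_carrier[OF U]
  have "{x \<in> topspace T. p x \<in> p ` U} = (\<Union>n\<in>N. n <# U)"
  proof (intro equalityI subsetI)
    fix x assume "x \<in> {x \<in> topspace T. p x \<in> p ` U}"
    then obtain u where "x \<in> carrier G" "u \<in> U" "p x = p u" by (auto simp: topspace_eq)
    then show "x \<in> (\<Union>n\<in>N. n <# U)" using p_eqD(1)[of x u] Uc by (auto simp: l_coset_image)
  next
    fix x assume "x \<in> (\<Union>n\<in>N. n <# U)"
    then show "x \<in> {x \<in> topspace T. p x \<in> p ` U}"
      using p_mult_left Uc mem_carrier by (auto simp: l_coset_image topspace_eq)
  qed
  moreover have "openin T (\<Union>n\<in>N. n <# U)"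
    using U mem_carrier by (auto intro!: openin_l_coset)
  ultimately show "openin Q (p ` U)"
    using Uc by (auto simp: openin_quotient_topology topspace_eq)
qed

text \<open>A product of quotient maps can fail to be a quotient map; here openness of
  \<open>p\<close> rescues it. Continuity of multiplication downstairs is then checked
  upstairs.\<close>

lemma quotient_map_p_prod:
  "quotient_map (prod_topology T T) (prod_topology Q Q) (\<lambda>(x, y). (p x, p y))"
proof (rule continuous_open_imp_quotient_map)
  show "continuous_map (prod_topology T T) (prod_topology Q Q) (\<lambda>(x, y). (p x, p y))"
    unfolding case_prod_unfold
    by (intro continuous_map_pairedI continuous_map_compose[OF continuous_map_fst continuous_map_p, unfolded o_def]
        continuous_map_compose[OF continuous_map_snd continuous_map_p, unfolded o_def])
  show "(\<lambda>(x, y). (p x, p y)) ` topspace (prod_topology T T) = topspace (prod_topology Q Q)"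
    by auto
  show "open_map (prod_topology T T) (prod_topology Q Q) (\<lambda>(x, y). (p x, p y))"
    unfolding open_map_def
  proof (intro allI impI)
    fix W assume W: "openin (prod_topology T T) W"
    show "openin (prod_topology Q Q) ((\<lambda>(x, y). (p x, p y)) ` W)"
      unfolding openin_prod_topology_alt
    proof (intro allI impI)
      fix A B assume "(A, B) \<in> (\<lambda>(x, y). (p x, p y)) ` W"
      then obtain x y where xy: "(x, y) \<in> W" "A = p x" "B = p y" by auto
      then obtain U V where UV: "openin T U" "openin T V" "x \<in> U" "y \<in> V" "U \<times> V \<subseteq> W"
        using W unfolding openin_prod_topology_alt by metis
      have "p ` U \<times> p ` V \<subseteq> (\<lambda>(x, y). (p x, p y)) ` W" using UV(5) by force
      moreover have "openin Q (p ` U)" "openin Q (p ` V)"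
        using UV(1,2) open_map_p by (simp_all add: open_map_def)
      moreover have "A \<in> p ` U" "B \<in> p ` V" using UV(3,4) xy(2,3) by simp_all
      ultimately show "\<exists>U V. openin Q U \<and> openin Q V \<and> A \<in> U \<and> B \<in> V \<and> U \<times> V \<subseteq> (\<lambda>(x, y). (p x, p y)) ` W"
        by (intro exI[of _ "p ` U"] exI[of _ "p ` V"] conjI)
    qed
  qed
qed

lemma locally_compact_quotient: "locally_compact_group (G Mod N) Q"
proof -
  interpret Q: group "G Mod N" by (rule factorgroup_is_group)
  show ?thesis
  proof
    show "topspace Q = carrier (G Mod N)" by (simp add: topspace_eq carrier_Mod)
    show "continuous_map (prod_topology Q Q) Q (\<lambda>(A, B). A \<otimes>\<^bsub>G Mod N\<^esub> B)"
    proof (rule continuous_compose_quotient_map[OF quotient_map_p_prod])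
      have "continuous_map (prod_topology T T) Q (\<lambda>z. p (fst z \<otimes> snd z))"
        using continuous_map_compose[OF continuous_mult continuous_map_p] by (simp add: o_def case_prod_unfold)
      then show "continuous_map (prod_topology T T) Q ((\<lambda>(A, B). A \<otimes>\<^bsub>G Mod N\<^esub> B) \<circ> (\<lambda>(x, y). (p x, p y)))"
        by (rule continuous_map_eq) (auto simp: topspace_eq p_mult)
    qed
    show "continuous_map Q Q (\<lambda>A. inv\<^bsub>G Mod N\<^esub> A)"
    proof (rule continuous_compose_quotient_map[OF quotient_map_p])
      have "continuous_map T Q (\<lambda>x. p (inv x))"
        using continuous_map_compose[OF continuous_inv continuous_map_p] by (simp add: o_def)
      then show "continuous_map T Q ((\<lambda>A. inv\<^bsub>G Mod N\<^esub> A) \<circ> p)"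
        by (rule continuous_map_eq) (simp add: topspace_eq p_inv)
    qed
    show "locally_compact_space Q"
      by (rule locally_compact_space_continuous_open_map_image[OF continuous_map_p open_map_p _ locally_compact])
        simp
    show "Hausdorff_space Q"
      unfolding Hausdorff_space_def
    proof (intro allI impI, elim conjE)
      fix A B assume "A \<in> topspace Q" "B \<in> topspace Q" "A \<noteq> B"
      then obtain x y where xy: "x \<in> carrier G" "y \<in> carrier G" "A = p x" "B = p y" "p x \<noteq> p y"
        by (auto simp: topspace_eq)
      \<comment> \<open>Pairs in different cosets. This set is open because \<open>N\<close> is
        closed, and a product neighbourhood inside it projects to disjoint neighbourhoods of the two
        cosets.\<close>
      define W where "W = {z \<in> topspace (prod_topology T T). fst z \<otimes> inv (snd z) \<in> topspace T - N}"
      have W: "openin (prod_topology T T) W"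
        unfolding W_def
      proof (rule openin_continuous_map_preimage)
        show "continuous_map (prod_topology T T) T (\<lambda>z. fst z \<otimes> inv (snd z))"
          by (intro continuous_group_intros continuous_map_fst continuous_map_snd)
        show "openin T (topspace T - N)" using closed by blast
      qed
      have diff: "x' \<otimes> inv y' \<notin> N" if "x' \<in> carrier G" "y' \<in> carrier G" "p x' \<noteq> p y'" for x' y'
        using p_mult_left[of "x' \<otimes> inv y'" y'] that by (auto simp: m_assoc)
      have "(x, y) \<in> W" using xy diff[of x y] by (simp add: W_def topspace_eq)
      then obtain U V where UV: "openin T U" "openin T V" "x \<in> U" "y \<in> V" "U \<times> V \<subseteq> W"
        using W unfolding openin_prod_topology_alt by metis
      have "p u \<noteq> p v" if "u \<in> U" "v \<in> V" for u v
      proof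
        assume eq: "p u = p v"
        have uv: "u \<in> carrier G" "v \<in> carrier G" using that UV openin_subset_carrier by blast+
        obtain n where "n \<in> N" "u = n \<otimes> v" using p_eqD(1)[OF uv eq] by blast
        then have "u \<otimes> inv v \<in> N" using uv mem_carrier by (simp add: m_assoc)
        moreover have "(u, v) \<in> W" using that UV(5) by blast
        ultimately show False by (simp add: W_def)
      qed
      then have "disjnt (p ` U) (p ` V)" by (auto simp: disjnt_def)
      moreover have "openin Q (p ` U)" "openin Q (p ` V)"
        using UV(1,2) open_map_p by (simp_all add: open_map_def)
      moreover have "A \<in> p ` U" "B \<in> p ` V" using UV(3,4) xy(3,4) by simp_all
      ultimately show "\<exists>U V. openin Q U \<and> openin Q V \<and> A \<in> U \<and> B \<in> V \<and> disjnt U V"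
        by (intro exI[of _ "p ` U"] exI[of _ "p ` V"] conjI)
    qed
  qed
qed

sublocale quot: locally_compact_group "G Mod N" Q
  by (rule locally_compact_quotient)

sublocale sub: locally_compact_group "G\<lparr>carrier := N\<rparr>" "subtopology T N"
  by (rule locally_compact_subgroup[OF subgroup_axioms closed])

end

section \<open>Integration along the fibres of the quotient map\<close>

text \<open>The Haar measure on \<open>N\<close> is a parameter, so that the instances for the group
  and for the subgroup \<open>H\<close> can share one.\<close>

locale closed_normal_subgroup_haar = closed_normal_subgroup +
  fixes \<nu> :: "'a measure"
  assumes haar_N: "left_haar_measure (G\<lparr>carrier := N\<rparr>) (subtopology T N) \<nu>"
begin

sublocale \<nu>: haar "G\<lparr>carrier := N\<rparr>" "subtopology T N" \<nu>
  by unfold_locales (rule haar_N)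

lemma space_\<nu>: "space \<nu> = N"
  using \<nu>.space_eq_carrier by simp

lemma compactly_supported_fiber:
  assumes f: "f \<in> compactly_supported T" and x: "x \<in> carrier G"
  shows "(\<lambda>n. f (x \<otimes> n)) \<in> compactly_supported (subtopology T N)"
proof -
  obtain K where K: "continuous_map T euclideanreal (\<lambda>n. f (x \<otimes> n))" "compactin T K"
    "\<And>n. n \<in> topspace T \<Longrightarrow> n \<notin> K \<Longrightarrow> f (x \<otimes> n) = 0"
    using compactly_supported_left_translate[OF f x] by (rule compactly_supportedE) blast
  have "compactin (subtopology T N) (N \<inter> K)"
    using closed_Int_compactin[OF closed K(2)] by (simp add: compactin_subtopology)
  then show ?thesis
    by (rule compactly_supportedI[OF sub.Hausdorff continuous_map_from_subtopology[OF K(1)]])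
      (use K(3) in auto)
qed

definition fiber_integral :: "('a \<Rightarrow> real) \<Rightarrow> 'a \<Rightarrow> real" where
  "fiber_integral f x = (LINT n|\<nu>. f (x \<otimes> n))"

text \<open>A representative of the coset is chosen; left invariance of \<nu> makes the value
  independent of the choice, as \<open>quotient_integral_p\<close> records.\<close>

definition quotient_integral :: "('a \<Rightarrow> real) \<Rightarrow> 'a set \<Rightarrow> real" where
  "quotient_integral f A = fiber_integral f (SOME x. x \<in> carrier G \<and> p x = A)"

lemma continuous_map_fiber_integral:
  assumes f: "f \<in> compactly_supported T"
  shows "continuous_map T euclideanreal (fiber_integral f)"
  unfolding fiber_integral_def[abs_def]
proof (rule \<nu>.integral.continuous_map_functional)
  obtain K where K: "continuous_map T euclideanreal f" "compactin T K"
    "\<And>x. x \<in> topspace T \<Longrightarrow> x \<notin> K \<Longrightarrow> f x = 0" using f by (rule compactly_supportedE) blast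
  have "continuous_map (prod_topology T (subtopology T N)) T (\<lambda>z. fst z \<otimes> snd z)"
    by (intro continuous_group_intros continuous_map_fst
        continuous_map_into_fulltopology[OF continuous_map_snd])
  from continuous_map_compose[OF this K(1)]
  show "continuous_map (prod_topology T (subtopology T N)) euclideanreal (\<lambda>(x, n). f (x \<otimes> n))"
    by (simp add: o_def case_prod_unfold)
  fix x assume "x \<in> topspace T"
  then obtain U L where UL: "openin T U" "compactin T L" "x \<in> U" "U \<subseteq> L"
    using locally_compact unfolding locally_compact_space_def by metis
  let ?C = "N \<inter> ((\<lambda>x. inv x) ` L <#> K)"
  have "compactin T ((\<lambda>x. inv x) ` L <#> K)"
    by (rule compactin_set_mult[OF compactin_inv_image[OF UL(2)] K(2)])
  then have C: "compactin (subtopology T N) ?C"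
    using closed_Int_compactin[OF closed] by (simp add: compactin_subtopology)
  \<comment> \<open>For \<open>y\<close> in the compact set \<open>L\<close>, the part of the fibre
    on which the integrand can be nonzero lies in the inverses of \<open>L\<close> times
    \<open>K\<close>, uniformly in \<open>y\<close>.\<close>
  have "f (y \<otimes> n) = 0" if y: "y \<in> U" and n: "n \<in> topspace (subtopology T N) - ?C" for y n
  proof (rule K(3))
    have c: "y \<in> carrier G" "n \<in> carrier G"
      using y n openin_subset_carrier[OF UL(1)] by (auto simp: topspace_eq)
    then show "y \<otimes> n \<in> topspace T" by (simp add: topspace_eq)
    show "y \<otimes> n \<notin> K"
    proof
      assume k: "y \<otimes> n \<in> K"
      have "inv y \<in> (\<lambda>x. inv x) ` L" using y UL(4) by blast
      moreover have "n = inv y \<otimes> (y \<otimes> n)" using c by (simp add: m_assoc[symmetric])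
      ultimately have "n \<in> (\<lambda>x. inv x) ` L <#> K" using k unfolding set_mult_def by blast
      then show False using n by simp
    qed
  qed
  then show "\<exists>U L. openin T U \<and> x \<in> U \<and> compactin (subtopology T N) L \<and>
      (\<forall>y\<in>U. \<forall>n\<in>topspace (subtopology T N) - L. f (y \<otimes> n) = 0)"
    using UL C by blast
qed

lemma fiber_integral_mult_right:
  assumes f: "f \<in> compactly_supported T" and x: "x \<in> carrier G" and m: "m \<in> N"
  shows "fiber_integral f (x \<otimes> m) = fiber_integral f x"
proof -
  have "fiber_integral f (x \<otimes> m) = (LINT n|\<nu>. f (x \<otimes> (m \<otimes> n)))"
    unfolding fiber_integral_def
    by (rule Bochner_Integration.integral_cong) (use x m in \<open>auto simp: space_\<nu> m_assoc\<close>)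
  also have "\<dots> = fiber_integral f x"
    unfolding fiber_integral_def
    using \<nu>.integral_left_invariant[OF compactly_supported_fiber[OF f x], of m] m by simp
  finally show ?thesis .
qed

lemma quotient_integral_p:
  assumes f: "f \<in> compactly_supported T" and x: "x \<in> carrier G"
  shows "quotient_integral f (p x) = fiber_integral f x"
proof -
  define y where "y = (SOME y. y \<in> carrier G \<and> p y = p x)"
  have y: "y \<in> carrier G \<and> p y = p x"
    unfolding y_def by (rule someI[of _ x]) (use x in simp)
  then obtain m where m: "m \<in> N" "y = x \<otimes> m" using p_eqD(2)[of y x] x by blast
  have "quotient_integral f (p x) = fiber_integral f y" by (simp add: quotient_integral_def y_def)
  then show ?thesis using m fiber_integral_mult_right[OF f x] by simp
qed

lemma compactly_supported_quotient_integral: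
  assumes f: "f \<in> compactly_supported T"
  shows "quotient_integral f \<in> compactly_supported Q"
proof -
  obtain K where K: "continuous_map T euclideanreal f" "compactin T K"
    "\<And>x. x \<in> topspace T \<Longrightarrow> x \<notin> K \<Longrightarrow> f x = 0" using f by (rule compactly_supportedE) blast
  show ?thesis
  proof (rule compactly_supportedI[OF quot.Hausdorff])
    have "continuous_map T euclideanreal (quotient_integral f \<circ> p)"
      by (rule continuous_map_eq[OF continuous_map_fiber_integral[OF f]])
        (simp add: topspace_eq quotient_integral_p[OF f])
    then show "continuous_map Q euclideanreal (quotient_integral f)"
      by (rule continuous_compose_quotient_map[OF quotient_map_p])
    show "compactin Q (p ` K)" by (rule image_compactin[OF K(2) continuous_map_p])
    fix A assume A: "A \<in> topspace Q" "A \<notin> p ` K"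
    then obtain x where x: "x \<in> carrier G" "A = p x" by (auto simp: topspace_eq)
    have "f (x \<otimes> n) = 0" if n: "n \<in> N" for n
    proof (rule K(3))
      show "x \<otimes> n \<in> topspace T" using x n by (simp add: topspace_eq)
      show "x \<otimes> n \<notin> K" using A(2) x(2) p_mult_right[OF n x(1)] by (metis imageI)
    qed
    then have "fiber_integral f x = (LINT n|\<nu>. 0)"
      unfolding fiber_integral_def by (intro Bochner_Integration.integral_cong) (auto simp: space_\<nu>)
    then show "quotient_integral f A = 0" using x quotient_integral_p[OF f x(1)] by simp
  qed
qed

lemma fiber_integral_nonneg:
  assumes "\<And>x. x \<in> carrier G \<Longrightarrow> 0 \<le> f x" "x \<in> carrier G"
  shows "0 \<le> fiber_integral f x"
  unfolding fiber_integral_def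
  using assms by (intro Bochner_Integration.integral_nonneg) (simp add: space_\<nu>)

lemma positive_functional_quotient_integral:
  assumes "positive_functional Q J"
  shows "positive_functional T (\<lambda>f. J (quotient_integral f))"
proof -
  interpret J: positive_functional_on Q J
    using assms quot.Hausdorff quot.locally_compact by (simp add: positive_functional_on_def)
  note Cc = compactly_supported_quotient_integral
  show ?thesis
    unfolding positive_functional_def
  proof (intro conjI ballI allI impI)
    fix f g assume f: "f \<in> compactly_supported T" and g: "g \<in> compactly_supported T"
    note fg = compactly_supported_add[OF Hausdorff f g]
    have "quotient_integral (\<lambda>x. f x + g x) A = quotient_integral f A + quotient_integral g A"
      if A: "A \<in> topspace Q" for A
    proof -
      obtain x where x: "x \<in> carrier G" "A = p x" using A by (auto simp: topspace_eq)
      then show ?thesis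
        using \<nu>.integrable_compactly_supported[OF compactly_supported_fiber] f g
        by (simp add: quotient_integral_p fg fiber_integral_def)
    qed
    then have "J (quotient_integral (\<lambda>x. f x + g x)) = J (\<lambda>A. quotient_integral f A + quotient_integral g A)"
      by (intro J.functional_cong Cc fg compactly_supported_add[OF J.T2] f g)
    then show "J (quotient_integral (\<lambda>x. f x + g x)) = J (quotient_integral f) + J (quotient_integral g)"
      using J.functional_add[OF Cc[OF f] Cc[OF g]] by simp
  next
    fix f c assume f: "f \<in> compactly_supported T"
    have "quotient_integral (\<lambda>x. c * f x) = (\<lambda>A. c * quotient_integral f A)"
      by (simp add: fun_eq_iff quotient_integral_def fiber_integral_def)
    then show "J (quotient_integral (\<lambda>x. c * f x)) = c * J (quotient_integral f)"
      using J.functional_scale[OF Cc[OF f]] by simp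
  next
    fix f assume f: "f \<in> compactly_supported T" and nn: "\<forall>x\<in>topspace T. 0 \<le> f x"
    show "0 \<le> J (quotient_integral f)"
      by (rule J.functional_nonneg[OF Cc[OF f]])
        (use nn fiber_integral_nonneg[of f] in \<open>auto simp: topspace_eq quotient_integral_p[OF f]\<close>)
  qed
qed

text \<open>Left translation by \<open>x\<close> does not disturb the fibre variable, which stands
  on the right, and descends to left translation by \<open>p x\<close>.\<close>

lemma left_invariant_quotient_integral:
  assumes "positive_functional Q J" and inv: "left_invariant_functional (G Mod N) Q J"
  shows "left_invariant_functional G T (\<lambda>f. J (quotient_integral f))"
  unfolding left_invariant_functional_def
proof (intro ballI)
  interpret J: positive_functional_on Q J
    using assms quot.Hausdorff quot.locally_compact by (simp add: positive_functional_on_def)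
  note Cc = compactly_supported_quotient_integral
  fix f x assume f: "f \<in> compactly_supported T" and x: "x \<in> carrier G"
  have px: "p x \<in> carrier (G Mod N)" using x by (simp add: carrier_Mod)
  note fx = compactly_supported_left_translate[OF f x]
  have "J (quotient_integral (\<lambda>y. f (x \<otimes> y))) = J (\<lambda>A. quotient_integral f (p x \<otimes>\<^bsub>G Mod N\<^esub> A))"
  proof (rule J.functional_cong[OF Cc[OF fx] quot.compactly_supported_left_translate[OF Cc[OF f] px]])
    fix A assume "A \<in> topspace Q"
    then obtain y where y: "y \<in> carrier G" "A = p y" by (auto simp: topspace_eq)
    have "quotient_integral (\<lambda>y. f (x \<otimes> y)) A = (LINT n|\<nu>. f (x \<otimes> y \<otimes> n))"
      unfolding y(2) quotient_integral_p[OF fx y(1)] fiber_integral_def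
      by (intro Bochner_Integration.integral_cong) (use x y in \<open>auto simp: space_\<nu> m_assoc\<close>)
    then show "quotient_integral (\<lambda>y. f (x \<otimes> y)) A = quotient_integral f (p x \<otimes>\<^bsub>G Mod N\<^esub> A)"
      using x y by (simp add: p_mult quotient_integral_p[OF f] fiber_integral_def)
  qed
  also have "\<dots> = J (quotient_integral f)"
    using inv Cc[OF f] px by (simp add: left_invariant_functional_def)
  finally show "J (quotient_integral (\<lambda>y. f (x \<otimes> y))) = J (quotient_integral f)" .
qed

text \<open>By uniqueness of Haar measure, integrating first over the cosets of \<open>N\<close> and then over
  \<open>G Mod N\<close> is Haar integration on \<open>G\<close> (Weil's formula). Substituting \<open>x n h = (x h) (h\<inverse> n h)\<close> in the
  inner integral compares the modular functions.\<close>

lemma modular_function_quotient: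
  assumes h: "h \<in> carrier G"
    and \<delta>: "\<And>k. k \<in> compactly_supported (subtopology T N) \<Longrightarrow>
       (LINT n|\<nu>. k (inv h \<otimes> n \<otimes> h)) = \<delta> * (LINT n|\<nu>. k n)"
  shows "modular_function G T h / modular_function (G Mod N) Q (p h) = inverse \<delta>"
proof -
  obtain \<rho> where "haar (G Mod N) Q \<rho>" by (rule quot.haar_exists)
  then interpret \<rho>: haar "G Mod N" Q \<rho> .
  note Cc = compactly_supported_quotient_integral
  define J where "J f = (LINT A|\<rho>. quotient_integral f A)" for f
  have J: "positive_functional T J" "left_invariant_functional G T J"
    unfolding J_def[abs_def]
    using positive_functional_quotient_integral[OF \<rho>.integral.pf]
      left_invariant_quotient_integral[OF \<rho>.integral.pf \<rho>.left_invariant_integral] by simp_all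
  have ph: "p h \<in> carrier (G Mod N)" using h by (simp add: carrier_Mod)
  \<comment> \<open>A function with \<open>0 < J f\<close>, so that \<open>J f\<close> can be
    cancelled when the two scaling factors are compared.\<close>
  obtain f where f: "f \<in> compactly_supported T" "\<And>x. x \<in> topspace T \<Longrightarrow> 0 \<le> f x" "\<And>x. x \<in> {\<one>} \<Longrightarrow> f x = 1"
    using compactly_supported_cutoff[OF Hausdorff locally_compact, of "{\<one>}"] by (auto simp: topspace_eq)
  have "0 < (LINT n|\<nu>. f (\<one> \<otimes> n))"
    by (rule \<nu>.integral_pos[OF compactly_supported_fiber[OF f(1)], of _ \<one>])
      (use f in \<open>auto simp: topspace_eq\<close>)
  then have "0 < quotient_integral f (p \<one>)"
    by (simp add: quotient_integral_p[OF f(1)] fiber_integral_def)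
  then have Jf: "0 < J f"
    unfolding J_def
    by (intro \<rho>.integral_pos[OF Cc[OF f(1)], of "p \<one>"])
      (use f(2) fiber_integral_nonneg[of f] in \<open>auto simp: topspace_eq carrier_Mod quotient_integral_p[OF f(1)]\<close>)
  note fh = compactly_supported_right_translate[OF f(1) h]
  \<comment> \<open>Right translation by \<open>h\<close> splits into conjugation on the fibre,
    which contributes \<delta>, and right translation by \<open>p h\<close> on the quotient.\<close>
  have "J (\<lambda>l. f (l \<otimes> h)) = (LINT A|\<rho>. \<delta> * quotient_integral f (A \<otimes>\<^bsub>G Mod N\<^esub> p h))"
    unfolding J_def
  proof (rule Bochner_Integration.integral_cong[OF refl])
    fix A assume "A \<in> space \<rho>"
    then obtain x where x: "x \<in> carrier G" "A = p x"
      by (auto simp: \<rho>.space_eq_carrier carrier_Mod)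
    have "quotient_integral (\<lambda>l. f (l \<otimes> h)) A = (LINT n|\<nu>. f (x \<otimes> h \<otimes> (inv h \<otimes> n \<otimes> h)))"
      unfolding x(2) quotient_integral_p[OF fh x(1)] fiber_integral_def
    proof (rule Bochner_Integration.integral_cong[OF refl])
      fix n assume "n \<in> space \<nu>"
      then have n: "n \<in> carrier G" by (simp add: space_\<nu>)
      show "f (x \<otimes> n \<otimes> h) = f (x \<otimes> h \<otimes> (inv h \<otimes> n \<otimes> h))"
        using n x h by (simp add: m_assoc mult_inv_cancel)
    qed
    also have "\<dots> = \<delta> * (LINT n|\<nu>. f (x \<otimes> h \<otimes> n))"
      by (rule \<delta>[OF compactly_supported_fiber[OF f(1)]]) (use x h in simp)
    also have "\<dots> = \<delta> * quotient_integral f (A \<otimes>\<^bsub>G Mod N\<^esub> p h)"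
      using x h by (simp add: p_mult quotient_integral_p[OF f(1)] fiber_integral_def)
    finally show "quotient_integral (\<lambda>l. f (l \<otimes> h)) A = \<delta> * quotient_integral f (A \<otimes>\<^bsub>G Mod N\<^esub> p h)" .
  qed
  also have "\<dots> = \<delta> * (inverse (modular_function (G Mod N) Q (p h)) * J f)"
    using quot.functional_right_translate[OF \<rho>.integral.pf \<rho>.left_invariant_integral Cc[OF f(1)] ph]
    by (simp add: J_def)
  finally have "inverse (modular_function G T h) * J f = \<delta> * inverse (modular_function (G Mod N) Q (p h)) * J f"
    using functional_right_translate[OF J f(1) h] by simp
  then have "inverse (modular_function G T h) = \<delta> * inverse (modular_function (G Mod N) Q (p h))"
    using Jf by simp
  then show ?thesis
    using modular_function_pos[OF h] quot.modular_function_pos[OF ph] by (auto simp: field_simps)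
qed

text \<open>Conjugation by \<open>h\<close> is a homeomorphic automorphism of \<open>N\<close>, so
  integrating conjugated functions is again left-invariant; uniqueness on \<open>N\<close> supplies
  the factor.\<close>

lemma conjugation_modulus_exists:
  assumes h: "h \<in> carrier G"
  obtains \<delta> where "\<And>k. k \<in> compactly_supported (subtopology T N) \<Longrightarrow>
    (LINT n|\<nu>. k (inv h \<otimes> n \<otimes> h)) = \<delta> * (LINT n|\<nu>. k n)"
proof (rule \<nu>.left_invariant_functional_unique)
  let ?S = "subtopology T N"
  have conj: "continuous_map ?S ?S (\<lambda>n. inv g \<otimes> n \<otimes> g)" if g: "g \<in> carrier G" for g
    unfolding continuous_map_in_subtopology
  proof
    show "continuous_map ?S T (\<lambda>n. inv g \<otimes> n \<otimes> g)"
      by (intro continuous_map_from_subtopology continuous_group_intros) (use g in auto)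
    show "(\<lambda>n. inv g \<otimes> n \<otimes> g) \<in> topspace ?S \<rightarrow> N"
      using inv_op_closed1[OF g] by auto
  qed
  have conjCc: "(\<lambda>n. k (inv h \<otimes> n \<otimes> h)) \<in> compactly_supported ?S" if "k \<in> compactly_supported ?S" for k
  proof (rule compactly_supported_homeomorphic[OF sub.Hausdorff that conj[OF h] conj[of "inv h"] sub.Hausdorff])
    fix n assume "n \<in> topspace ?S"
    then have n: "n \<in> carrier G" by (simp add: topspace_eq)
    show "inv (inv h) \<otimes> (inv h \<otimes> n \<otimes> h) \<otimes> inv h = n"
      using n h by (simp add: m_assoc mult_inv_cancel)
  qed (use h in simp)
  show "positive_functional ?S (\<lambda>k. LINT n|\<nu>. k (inv h \<otimes> n \<otimes> h))"
    by (rule positive_functional_compose[OF \<nu>.integral.pf conjCc])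
      (use inv_op_closed1[OF h] in \<open>auto simp: topspace_eq\<close>)
  show "left_invariant_functional (G\<lparr>carrier := N\<rparr>) ?S (\<lambda>k. LINT n|\<nu>. k (inv h \<otimes> n \<otimes> h))"
    unfolding left_invariant_functional_def
  proof (intro ballI)
    fix k m assume k: "k \<in> compactly_supported ?S" and "m \<in> carrier (G\<lparr>carrier := N\<rparr>)"
    then have m: "m \<in> N" by simp
    have hm: "h \<otimes> m \<otimes> inv h \<in> N" by (rule inv_op_closed2[OF h m])
    \<comment> \<open>Left translation by \<open>m\<close> after conjugation is left translation by
      h m h^-1 before it, and normality keeps that element in \<open>N\<close>.\<close>
    have "(LINT n|\<nu>. k (m \<otimes> (inv h \<otimes> n \<otimes> h))) = (LINT n|\<nu>. k (inv h \<otimes> (h \<otimes> m \<otimes> inv h \<otimes> n) \<otimes> h))"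
    proof (rule Bochner_Integration.integral_cong[OF refl])
      fix n assume "n \<in> space \<nu>"
      then have n: "n \<in> carrier G" by (simp add: space_\<nu>)
      have mc: "m \<in> carrier G" using m by simp
      show "k (m \<otimes> (inv h \<otimes> n \<otimes> h)) = k (inv h \<otimes> (h \<otimes> m \<otimes> inv h \<otimes> n) \<otimes> h)"
        using n h mc by (simp add: m_assoc mult_inv_cancel)
    qed
    also have "\<dots> = (LINT n|\<nu>. k (inv h \<otimes> n \<otimes> h))"
      using \<nu>.integral_left_invariant[OF conjCc[OF k], of "h \<otimes> m \<otimes> inv h"] hm by simp
    finally show "(LINT n|\<nu>. k (m \<otimes>\<^bsub>G\<lparr>carrier := N\<rparr>\<^esub> (inv h \<otimes> n \<otimes> h))) = (LINT n|\<nu>. k (inv h \<otimes> n \<otimes> h))"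
      by simp
  qed
qed (use that in blast)

end

theorem corollary1p5:
  fixes G :: "('a, 'b) monoid_scheme" and T :: "'a topology" and H N :: "'a set" and h :: 'a
  assumes "locally_compact_group G T"
    and "subgroup H G" and "closedin T H"
    and "N \<lhd> G" and "closedin T N"
    and "N \<subseteq> H"
    and "h \<in> H"
  shows "modular_function G T h
           / modular_function (G Mod N) (quotient_topology T (coset_map G N)) (coset_map G N h)
       = modular_function (G\<lparr>carrier := H\<rparr>) (subtopology T H) h
           / modular_function (G\<lparr>carrier := H\<rparr> Mod N)
               (quotient_topology (subtopology T H) (coset_map G N)) (coset_map G N h)"
proof -
  interpret lcg: locally_compact_group G T by fact
  interpret G: closed_normal_subgroup G T N
    using assms by (intro closed_normal_subgroup.intro closed_normal_subgroup_axioms.intro)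
  let ?H = "G\<lparr>carrier := H\<rparr>" and ?TH = "subtopology T H"
  have sub_N: "subtopology ?TH N = subtopology T N"
    using assms(6) by (simp add: subtopology_subtopology Int_absorb1)
  \<comment> \<open>Restricting the carrier leaves the multiplication unchanged, so both groups have
    literally the same coset map.\<close>
  have coset: "coset_map ?H N = coset_map G N"
    by (auto simp: coset_map_def r_coset_def)
  have "N \<lhd> ?H" by (rule lcg.normal_restrict_supergroup[OF assms(2,4,6)])
  moreover have "closedin ?TH N"
    using assms(5,6) by (simp add: closedin_subset_topspace)
  ultimately interpret H: closed_normal_subgroup ?H ?TH N
    using lcg.locally_compact_subgroup[OF assms(2,3)]
    by (intro closed_normal_subgroup.intro closed_normal_subgroup_axioms.intro)
  \<comment> \<open>One Haar measure on \<open>N\<close> serves both instances: the group structure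
    and the topology induced on \<open>N\<close> through \<open>H\<close> agree with those induced
    from \<open>G\<close>. Hence the same \<delta> appears in both quotients.\<close>
  obtain \<nu> where \<nu>: "haar (G\<lparr>carrier := N\<rparr>) (subtopology T N) \<nu>" by (rule G.sub.haar_exists)
  then interpret G: closed_normal_subgroup_haar G T N \<nu>
    by unfold_locales (rule haar.lh)
  interpret H: closed_normal_subgroup_haar ?H ?TH N \<nu>
    by unfold_locales (use haar.lh[OF \<nu>] in \<open>simp add: sub_N\<close>)
  have h: "h \<in> carrier G" using assms(2,7) subgroup.mem_carrier by metis
  have inv: "inv\<^bsub>?H\<^esub> h = inv\<^bsub>G\<^esub> h" by (rule lcg.m_inv_consistent[OF assms(2,7)])
  obtain \<delta> where \<delta>: "\<And>k. k \<in> compactly_supported (subtopology T N) \<Longrightarrow>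
    (LINT n|\<nu>. k (inv\<^bsub>G\<^esub> h \<otimes>\<^bsub>G\<^esub> n \<otimes>\<^bsub>G\<^esub> h)) = \<delta> * (LINT n|\<nu>. k n)"
    using G.conjugation_modulus_exists[OF h] by metis
  have "modular_function G T h / modular_function (G Mod N) (quotient_topology T (coset_map G N)) (coset_map G N h)
      = inverse \<delta>"
    by (rule G.modular_function_quotient[OF h \<delta>])
  moreover have "modular_function ?H ?TH h
      / modular_function (?H Mod N) (quotient_topology ?TH (coset_map G N)) (coset_map G N h) = inverse \<delta>"
    using H.modular_function_quotient[of h \<delta>] assms(7) \<delta> by (simp add: sub_N coset inv)
  ultimately show ?thesis by simp
qed

end
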